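(* Let $\delta>0$ and let $L_\delta=\{\delta(s+ik):s,k\in\mathbb{Z},\ s+k\text{ even}\}$, where each point $z$ is adjacent to the four points $z+\delta(\pm1\pm i)$. Let $S=\{2j\delta: j\in\mathbb{Z},\ j\ge0\}\subset L_\delta$ (the slit along the positive real axis), and for $z\in L_\delta$ let $\operatorname{hm}(z)$ denote the probability that simple random walk on $L_\delta$ started at $z$ hits $S$ for the first time at $0$ (so $\operatorname{hm}(0)=1$ and $\operatorname{hm}=0$ on $S\setminus\{0\}$); equivalently $\operatorname{hm}$ is the unique function discrete harmonic on $L_\delta\setminus S$, equal to $1$ at $0$, to $0$ on $S\setminus\{0\}$, and tending to $0$ at infinity. Then for all $s,k\in\mathbb{Z}$ with $s+k$ even, $$\operatorname{hm}\big((s+ik)\delta\big)=\frac{1}{2\pi}\int_{-\pi}^{\pi}\frac{C(\theta)^{|k|}}{\sqrt{1-e^{-2i\theta}}}\,e^{-is\theta}\,d\theta,\qquad C(\theta)=\frac{\cos\theta}{1+|\sin\theta|},$$ where the square root is the principal branch. In particular, for every integer $s\ge0$, $$\operatorname{hm}\big(-2(s+1)\delta\big)=\frac{s+\frac12}{s+1}\,\operatorname{hm}(-2s\delta),$$ and consequently $\operatorname{hm}(-2s\delta)\sim\frac{1}{\sqrt{\pi s}}$ as $s\to\infty$.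
   Context: A function $L$ on $L_\delta$ is discrete harmonic at $x$ if $L(x+(1+i)\delta)+L(x+(1-i)\delta)+L(x-(1+i)\delta)+L(x-(1-i)\delta)=4L(x)$. *)

theory Defs
  imports "HOL-Analysis.Analysis" "HOL-Library.Landau_Symbols"
begin

definition lattice :: "real \<Rightarrow> complex set" where
  "lattice \<delta> = {complex_of_real \<delta> * (of_int s + \<i> * of_int k) | s k :: int. even (s + k)}"

definition slit :: "real \<Rightarrow> complex set" where
  "slit \<delta> = {complex_of_real (2 * real j * \<delta>) | j :: nat. True}"

definition discrete_harmonic_at :: "real \<Rightarrow> (complex \<Rightarrow> real) \<Rightarrow> complex \<Rightarrow> bool" where
  "discrete_harmonic_at \<delta> L x \<longleftrightarrow>
     L (x + (1 + \<i>) * complex_of_real \<delta>) + L (x + (1 - \<i>) * complex_of_real \<delta>)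
     + L (x - (1 + \<i>) * complex_of_real \<delta>) + L (x - (1 - \<i>) * complex_of_real \<delta>) = 4 * L x"

text \<open>Characterisation of the harmonic measure of 0 in the slit: discrete harmonic on
  L_delta minus S, equal to 1 at 0, 0 on S minus {0}, tending to 0 at infinity
  (and, as a normalisation, 0 off the lattice).\<close>
definition is_hm :: "real \<Rightarrow> (complex \<Rightarrow> real) \<Rightarrow> bool" where
  "is_hm \<delta> f \<longleftrightarrow>
     (\<forall>z\<in>lattice \<delta> - slit \<delta>. discrete_harmonic_at \<delta> f z) \<and>
     f 0 = 1 \<and>
     (\<forall>z\<in>slit \<delta> - {0}. f z = 0) \<and>
     (\<forall>\<epsilon>>0. \<exists>R. \<forall>z\<in>lattice \<delta>. norm z > R \<longrightarrow> \<bar>f z\<bar> < \<epsilon>) \<and>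
     (\<forall>z. z \<notin> lattice \<delta> \<longrightarrow> f z = 0)"

definition hm :: "real \<Rightarrow> complex \<Rightarrow> real" where
  "hm \<delta> = (THE f. is_hm \<delta> f)"

definition Cfun :: "real \<Rightarrow> real" where
  "Cfun \<theta> = cos \<theta> / (1 + \<bar>sin \<theta>\<bar>)"

end

theory Submission
  imports Defs
begin

text \<open>
The explicit formula solves the Dirichlet problem on the slit lattice and a maximum principle makes the
solution unique. Off the real axis harmonicity holds under the integral sign, because
$C(\theta) + C(\theta)^{-1} = 2/\cos\theta$. On the negative real axis the Laplacian of the
formula is the Fourier coefficient of $|\sin\theta| / \sqrt{1 - e^{-2i\theta}} =
\frac12\sqrt{1 - e^{2i\theta}}$ at a frequency where this one-sided series has no term. On the
whole real axis the formula is a Fourier coefficient of $(1 - e^{-2i\theta})^{-1/2}$, read off from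
the binomial series; it gives the boundary values, the recursion and the asymptotics.
\<close>

section \<open>Integrability on the punctured interval\<close>

text \<open>At exponent -1/2 the binomial series does not converge absolutely on the unit circle, so
  coefficients are computed at radius r < 1 and r is sent to 1. Multiples of 1 / sqrt |sin x| serve
  as the integrable majorants throughout, which is why the square-root singularities at 0 and at
  both endpoints are treated first.

  The maximum principle needs decay in every direction of the plane. Far from the real axis |C| < 1
  gives it uniformly in s. On each of the finitely many remaining rows it is a Riemann-Lebesgue
  statement, accessible because C is a continuous function of cos alone and multiplication by cos
  only averages neighbouring coefficients.

  The integral formula is complex-valued a priori. Its imaginary part solves the Dirichlet problem
  with zero data, so the uniqueness that identifies \<open>hm\<close> also shows that the formula is
  real.\<close>

text \<open>The cubic Taylor bound gives sin x \<ge> x - x^3/6 \<ge> x/3 for 0 \<le> x \<le> 2. The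
  weaker constant 1/4 has a rational square root, the source of the factor 2 in the majorant
  below.\<close>

lemma quarter_le_sin:
  assumes "0 \<le> x" "x \<le> pi / 2"
  shows "x / 4 \<le> sin x"
proof -
  have "\<bar>sin x - (\<Sum>m<3. sin_coeff m * x ^ m)\<bar> \<le> inverse (fact 3) * \<bar>x\<bar> ^ 3"
    by (rule Maclaurin_sin_bound)
  moreover have "(\<Sum>m<3. sin_coeff m * x ^ m) = x"
    by (simp add: sin_coeff_def eval_nat_numeral)
  ultimately have "\<bar>sin x - x\<bar> \<le> x * (x * x) / 6"
    using assms by (simp add: power3_eq_cube fact_numeral)
  moreover have "x \<le> 2"
    using assms pi_less_4 by linarith
  hence "x * x \<le> 2 * 2"
    using assms by (intro mult_mono) auto
  hence "x * (x * x) \<le> x * 4"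
    using assms by (intro mult_left_mono) auto
  ultimately show ?thesis
    using assms by linarith
qed

text \<open>\<open>sqrt\<close> extends to the negative axis as an odd function, so one formula in
  |y| covers both signs and \<open>2 * sqrt (x - c)\<close> is a single antiderivative on both sides
  of \<open>c\<close>.\<close>

lemma DERIV_sqrt_nonzero:
  assumes "y \<noteq> 0"
  shows "(sqrt has_real_derivative 1 / (2 * sqrt \<bar>y\<bar>)) (at y)"
proof (rule DERIV_real_sqrt_generic[OF assms])
  show "1 / (2 * sqrt \<bar>y\<bar>) = inverse (sqrt y) / 2" if "0 < y"
    using that by (simp add: field_simps)
  show "1 / (2 * sqrt \<bar>y\<bar>) = - inverse (sqrt y) / 2" if "y < 0"
    using that by (simp add: field_simps real_sqrt_minus)
qed
lemma DERIV_sqrt_shift: 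
  assumes "x \<noteq> c"
  shows "((\<lambda>x. 2 * sqrt (x - c)) has_real_derivative 1 / sqrt \<bar>x - c\<bar>) (at x)"
proof -
    have "((\<lambda>x. sqrt (x - c)) has_real_derivative 1 / (2 * sqrt \<bar>x - c\<bar>)) (at x)"
      using DERIV_sqrt_nonzero[of "x - c"] assms
        DERIV_shift[of sqrt "1 / (2 * sqrt \<bar>x - c\<bar>)" x "-c"] by simp
    from DERIV_cmult[OF this, of 2] show ?thesis by simp
qed

lemma inverse_sqrt_integrable:
  fixes a b c :: real
  shows "(\<lambda>x. 1 / sqrt \<bar>x - c\<bar>) integrable_on {a..b}"
proof (cases "a \<le> b")
  case True
  have "((\<lambda>x. 1 / sqrt \<bar>x - c\<bar>) has_integral (2 * sqrt (b - c) - 2 * sqrt (a - c))) {a..b}"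
  \<comment> \<open>The antiderivative is continuous at \<open>c\<close> but not differentiable
    there, so \<open>c\<close> is the exceptional point.\<close>
  proof (rule fundamental_theorem_of_calculus_interior_strong[of "{c}"])
    show "continuous_on {a..b} (\<lambda>x. 2 * sqrt (x - c))"
      by (intro continuous_intros)
    fix x assume x: "x \<in> {a<..<b} - {c}"
    hence "x \<noteq> c" by simp
    from DERIV_sqrt_shift[OF this]
    show "((\<lambda>x. 2 * sqrt (x - c)) has_vector_derivative 1 / sqrt \<bar>x - c\<bar>) (at x)"
      by (simp only: has_real_derivative_iff_has_vector_derivative)
  qed (use True in simp_all)
  thus ?thesis by (rule has_integral_integrable)
qed (simp add: integrable_on_empty)

text \<open>Removes the zeros of sin from [-pi, pi]. At them \<open>1 - cis (- 2 * x)\<close>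
  vanishes and the totalised quotient takes the value 0; elsewhere the principal root is
  continuous.\<close>

definition punctured :: "real set" where
  "punctured = {-pi<..<0} \<union> {0<..<pi}"

lemma punctured_lebesgue: "punctured \<in> sets lebesgue"
  by (simp add: punctured_def)

lemma integral_punctured:
  fixes f :: "real \<Rightarrow> complex"
  shows "integral {-pi..pi} f = integral punctured f"
proof (rule integral_spike_set)
  have "{x \<in> {-pi..pi} - punctured. f x \<noteq> 0} \<subseteq> {-pi, 0, pi}"
    by (auto simp: punctured_def)
  thus "negligible {x \<in> {-pi..pi} - punctured. f x \<noteq> 0}"
    by (rule negligible_subset[OF negligible_finite, rotated]) auto
  show "negligible {x \<in> punctured - {-pi..pi}. f x \<noteq> 0}"
    by (rule empty_imp_negligible) (auto simp: punctured_def)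
qed

lemma sin_nonzero_punctured: "x \<in> punctured \<Longrightarrow> sin x \<noteq> 0"
  using sin_gt_zero[of x] sin_gt_zero[of "-x"] by (auto simp: punctured_def)

text \<open>Every point lies within pi/2 of a zero c among 0, pi, -pi, and then |sin x| = sin |x -
  c| \<ge> |x - c| / 4. Adding the three terms avoids recording which zero is nearest.\<close>

lemma inverse_sqrt_sin_bound:
  assumes "x \<in> punctured"
  shows "1 / sqrt \<bar>sin x\<bar> \<le> 2 * (1 / sqrt \<bar>x - 0\<bar> + 1 / sqrt \<bar>x - pi\<bar> + 1 / sqrt \<bar>x - (-pi)\<bar>)"
proof -
  have key: "1 / sqrt \<bar>sin x\<bar> \<le> 2 * (1 / sqrt \<bar>x - c\<bar>)"
    if "x \<noteq> c" "\<bar>x - c\<bar> \<le> pi / 2" "\<bar>sin x\<bar> = sin \<bar>x - c\<bar>" for c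
  proof -
    have "1 / sqrt \<bar>sin x\<bar> \<le> 1 / sqrt (\<bar>x - c\<bar> / 4)"
      using quarter_le_sin[of "\<bar>x - c\<bar>"] that by (intro divide_left_mono mult_pos_pos) auto
    thus ?thesis by (simp add: real_sqrt_divide)
  qed
  have nonneg: "1 / sqrt \<bar>x - c\<bar> \<ge> 0" for c by simp
  have "-pi < x \<and> x < 0 \<or> 0 < x \<and> x < pi"
    using assms by (auto simp: punctured_def)
  then consider "0 < x" "x \<le> pi/2" | "pi/2 \<le> x" "x < pi" | "-(pi/2) \<le> x" "x < 0" | "-pi < x" "x \<le> -(pi/2)"
    by linarith
  hence "1 / sqrt \<bar>sin x\<bar> \<le> 2 * (1 / sqrt \<bar>x - 0\<bar>)
      \<or> 1 / sqrt \<bar>sin x\<bar> \<le> 2 * (1 / sqrt \<bar>x - pi\<bar>)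
      \<or> 1 / sqrt \<bar>sin x\<bar> \<le> 2 * (1 / sqrt \<bar>x - (-pi)\<bar>)"
  proof cases
    case 1
    thus ?thesis using key[of 0] sin_gt_zero[of x] by auto
  next
    case 2
    have "\<bar>x - pi\<bar> = pi - x" using 2 by simp
    thus ?thesis using 2 key[of pi] sin_gt_zero[of x] by auto
  next
    case 3
    thus ?thesis using key[of 0] sin_gt_zero[of "- x"] by auto
  next
    case 4
    have "\<bar>x - (-pi)\<bar> = x + pi" using 4 by simp
    moreover have "sin x < 0" using 4 sin_gt_zero[of "- x"] pi_gt_zero by auto
    ultimately have "1 / sqrt \<bar>sin x\<bar> \<le> 2 * (1 / sqrt \<bar>x - (-pi)\<bar>)"
    proof (intro key)
      show "\<bar>x - (-pi)\<bar> \<le> pi / 2" "x \<noteq> -pi" using 4 by linarith+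
      show "\<bar>sin x\<bar> = sin \<bar>x - (-pi)\<bar>"
        using \<open>\<bar>x - (-pi)\<bar> = x + pi\<close> \<open>sin x < 0\<close> by simp
    qed
    thus ?thesis by blast
  qed
  moreover have "m \<le> 2 * a \<or> m \<le> 2 * b \<or> m \<le> 2 * c \<Longrightarrow> m \<le> 2 * (a + b + c)"
    if "0 \<le> a" "0 \<le> b" "0 \<le> c" for m a b c :: real
    using that by auto
  ultimately show ?thesis
    using nonneg by blast
qed

lemma inverse_sqrt_sin_integrable: "(\<lambda>x. 1 / sqrt \<bar>sin x\<bar>) integrable_on punctured"
proof (rule measurable_bounded_by_integrable_imp_integrable_real)
  let ?h = "\<lambda>x. 2 * (1 / sqrt \<bar>x - 0\<bar> + 1 / sqrt \<bar>x - pi\<bar> + 1 / sqrt \<bar>x - (-pi)\<bar>)"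
  have "?h integrable_on {-pi..pi}"
    by (intro integrable_on_mult_right integrable_add inverse_sqrt_integrable)
  thus "?h integrable_on punctured"
  proof (rule integrable_spike_set)
    show "negligible {x \<in> {-pi..pi} - punctured. ?h x \<noteq> 0}"
      by (rule negligible_subset[OF negligible_finite[of "{-pi, 0, pi}"]]) (auto simp: punctured_def)
    show "negligible {x \<in> punctured - {-pi..pi}. ?h x \<noteq> 0}"
      by (rule empty_imp_negligible) (auto simp: punctured_def)
  qed
  show "(\<lambda>x. 1 / sqrt \<bar>sin x\<bar>) \<in> borel_measurable (lebesgue_on punctured)"
    by (rule continuous_imp_measurable_on_sets_lebesgue)
      (auto intro!: continuous_intros punctured_lebesgue simp: sin_nonzero_punctured)
qed (use inverse_sqrt_sin_bound punctured_lebesgue in auto)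

lemma integrable_of_bound:
  fixes f :: "real \<Rightarrow> complex"
  assumes "continuous_on punctured f"
    and "\<And>x. x \<in> punctured \<Longrightarrow> norm (f x) \<le> B / sqrt \<bar>sin x\<bar>"
  shows "f integrable_on punctured"
    and "norm (integral punctured f) \<le> B * integral punctured (\<lambda>x. 1 / sqrt \<bar>sin x\<bar>)"
proof -
  have g: "(\<lambda>x. B * (1 / sqrt \<bar>sin x\<bar>)) integrable_on punctured"
    by (intro integrable_on_mult_right inverse_sqrt_sin_integrable)
  show f: "f integrable_on punctured"
    by (rule measurable_bounded_by_integrable_imp_integrable[OF _ g])
      (use assms in \<open>auto intro!: punctured_lebesgue continuous_imp_measurable_on_sets_lebesgue\<close>)
  have "norm (integral punctured f) \<le> integral punctured (\<lambda>x. B * (1 / sqrt \<bar>sin x\<bar>))"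
    by (rule integral_norm_bound_integral[OF f g]) (use assms in auto)
  also have "\<dots> = B * integral punctured (\<lambda>x. 1 / sqrt \<bar>sin x\<bar>)"
    by (rule integral_mult_right)
  finally show "norm (integral punctured f) \<le> B * integral punctured (\<lambda>x. 1 / sqrt \<bar>sin x\<bar>)" .
qed

section \<open>Fourier coefficients of powers of the one-sided symbol\<close>

lemma integral_cis:
  "integral {-pi..pi} (\<lambda>x. cis (of_int l * x)) = (if l = 0 then 2 * of_real pi else 0)"
proof (cases "l = 0")
  case False
  have "((\<lambda>x. cis (of_int l * x)) has_integral
      (cis (of_int l * pi) / (\<i> * of_int l) - cis (of_int l * (-pi)) / (\<i> * of_int l))) {-pi..pi}"
  proof (rule fundamental_theorem_of_calculus)
    fix x :: real
    have "((\<lambda>z. exp (\<i> * of_int l * z) / (\<i> * of_int l)) has_field_derivative exp (\<i> * of_int l * of_real x))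
      (at (of_real x))"
      using False by (auto intro!: derivative_eq_intros)
    from has_vector_derivative_real_field[OF this]
    show "((\<lambda>x. cis (of_int l * x) / (\<i> * of_int l)) has_vector_derivative cis (of_int l * x))
        (at x within {-pi..pi})"
      by (simp add: cis_conv_exp mult_ac)
  qed simp
  moreover have "cis (of_int l * pi) = cis (of_int l * (-pi))"
    using iffD2[OF sin_zero_iff_int2, of "of_int l * pi"] by (simp add: complex_eq_iff)
  ultimately show ?thesis
    using False by (simp add: integral_unique)
qed (simp add: scaleR_conv_of_real)

text \<open>Absolute summability bounds all partial sums by one constant, so dominated convergence
  permits termwise integration. Term n has frequency -2n - m, and orthogonality keeps only the n
  with m = -2n.\<close>

lemma integral_absolutely_convergent_series:
  fixes c :: "nat \<Rightarrow> complex"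
  assumes c: "summable (\<lambda>n. norm (c n))"
  shows "integral {-pi..pi} (\<lambda>x. (\<Sum>n. c n * cis (- 2 * x) ^ n) * cis (- of_int m * x)) =
    2 * of_real pi * (if m \<le> 0 \<and> even m then c (nat (- m div 2)) else 0)"
proof -
  define f where "f = (\<lambda>N x. (\<Sum>n<N. c n * cis (- 2 * x) ^ n) * cis (- of_int m * x))"
  have f_alt: "f N = (\<lambda>x. \<Sum>n<N. c n * cis (of_int (- 2 * int n - m) * x))" for N
  proof -
    have "cis (- 2 * x) ^ n * cis (- of_int m * x) = cis (of_int (- 2 * int n - m) * x)" for n x
    proof -
      have "real n * (- 2 * x) + - of_int m * x = of_int (- 2 * int n - m) * x"
        by (simp add: algebra_simps)
      thus ?thesis by (simp only: Complex.DeMoivre cis_mult)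
    qed
    thus ?thesis
      unfolding f_def sum_distrib_right mult.assoc by simp
  qed
  have int_cis: "(\<lambda>x. c n * cis (of_int l * x)) integrable_on {-pi..pi}" for n l
    by (intro integrable_continuous_interval continuous_intros)
  have lim: "(\<lambda>N. integral {-pi..pi} (f N)) \<longlonglongrightarrow>
      integral {-pi..pi} (\<lambda>x. (\<Sum>n. c n * cis (- 2 * x) ^ n) * cis (- of_int m * x))"
  proof (rule dominated_convergence(2))
    show "f N integrable_on {-pi..pi}" for N
      unfolding f_alt by (intro integrable_sum int_cis) auto
    show "(\<lambda>_. \<Sum>n. norm (c n)) integrable_on {-pi..pi}"
      by (rule integrable_const_ivl)
    show "norm (f N x) \<le> (\<Sum>n. norm (c n))" for N x
    proof -
      have "norm (f N x) \<le> (\<Sum>n<N. norm (c n))"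
        unfolding f_def norm_mult norm_cis mult_1_right
        by (rule order_trans[OF norm_sum]) (simp add: norm_mult norm_power)
      also have "\<dots> \<le> (\<Sum>n. norm (c n))"
        by (rule sum_le_suminf[OF c]) auto
      finally show ?thesis .
    qed
    show "(\<lambda>N. f N x) \<longlonglongrightarrow> (\<Sum>n. c n * cis (- 2 * x) ^ n) * cis (- of_int m * x)" for x
    proof -
      have "summable (\<lambda>n. c n * cis (- 2 * x) ^ n)"
        by (rule summable_norm_cancel) (use c in \<open>simp add: norm_mult norm_power\<close>)
      thus ?thesis
        unfolding f_def by (intro tendsto_mult tendsto_const summable_LIMSEQ)
    qed
  qed
  \<comment> \<open>For odd or positive \<open>m\<close> this index is a meaningless default; the
    inner conditional below then makes its term 0.\<close>
  define n0 where "n0 = nat (- m div 2)"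
  have "integral {-pi..pi} (f N) = (\<Sum>n<N. if n = n0 then 2 * of_real pi * (if m \<le> 0 \<and> even m then c n else 0) else 0)" for N
  proof -
    have "integral {-pi..pi} (f N) = (\<Sum>n<N. c n * integral {-pi..pi} (\<lambda>x. cis (of_int (- 2 * int n - m) * x)))"
      unfolding f_alt by (subst integral_sum) (auto intro!: int_cis simp del: of_int_diff of_int_mult)
    also have "\<dots> = (\<Sum>n<N. if n = n0 then 2 * of_real pi * (if m \<le> 0 \<and> even m then c n else 0) else 0)"
    proof (rule sum.cong[OF refl])
      fix n
      have "- 2 * int n - m = 0 \<longleftrightarrow> n = n0 \<and> m \<le> 0 \<and> even m"
      proof
        assume "- 2 * int n - m = 0"
        hence "m = - 2 * int n" by simp
        thus "n = n0 \<and> m \<le> 0 \<and> even m" by (simp add: n0_def)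
      next
        assume "n = n0 \<and> m \<le> 0 \<and> even m"
        thus "- 2 * int n - m = 0" by (auto simp: n0_def elim!: evenE)
      qed
      thus "c n * integral {-pi..pi} (\<lambda>x. cis (of_int (- 2 * int n - m) * x)) =
          (if n = n0 then 2 * of_real pi * (if m \<le> 0 \<and> even m then c n else 0) else 0)"
        unfolding integral_cis by auto
    qed
    finally show ?thesis .
  qed
  moreover have "(\<lambda>N. \<Sum>n<N. if n = n0 then 2 * of_real pi * (if m \<le> 0 \<and> even m then c n else 0) else 0)
      \<longlonglongrightarrow> 2 * of_real pi * (if m \<le> 0 \<and> even m then c n0 else 0)"
    using sums_single[of n0 "\<lambda>n. 2 * of_real pi * (if m \<le> 0 \<and> even m then c n else 0)"]
    by (simp only: sums_def)
  ultimately show ?thesis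
    using LIMSEQ_unique[OF lim] by (simp only: n0_def)
qed

section \<open>Estimates for 1 - r e^{-2ix}, uniform in the radius, and Abel summation\<close>

lemma Re_one_minus_cis: "Re (1 - cis (- 2 * x)) = 2 * (sin x)\<^sup>2"
  by (simp add: cos_double_sin)

lemma norm_one_minus_cis: "norm (1 - cis (- 2 * x)) = 2 * \<bar>sin x\<bar>"
proof -
  have "(norm (1 - cis (- 2 * x)))\<^sup>2 = (1 - cos (2 * x))\<^sup>2 + (sin (2 * x))\<^sup>2"
    by (simp add: cmod_power2)
  also have "\<dots> = 2 - 2 * cos (2 * x)"
    using sin_cos_squared_add[of "2 * x"] by (simp add: power2_diff)
  also have "\<dots> = (2 * \<bar>sin x\<bar>)\<^sup>2"
    by (simp add: cos_double_sin power_mult_distrib)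
  finally show ?thesis
    by (rule power2_eq_imp_eq) auto
qed

lemma one_minus_cis_nonpos_Reals:
  assumes "x \<in> punctured"
  shows "1 - cis (- 2 * x) \<notin> \<real>\<^sub>\<le>\<^sub>0"
  using Re_one_minus_cis[of x] sin_nonzero_punctured[OF assms]
  by (metis complex_nonpos_Reals_iff not_less mult_pos_pos zero_less_numeral zero_less_power2)

text \<open>Re (1 - r e^{iy}) \<ge> 1 - r > 0 keeps the base off the branch cut. As 1 - e^{iy}
  differs from 1 - r e^{iy} by a vector of length 1 - r, the same bound shows that shrinking the
  radius costs at most a factor 2.\<close>

lemma scaled_one_minus_cis:
  fixes r :: real
  assumes "0 \<le> r" "r < 1"
  shows "1 - of_real r * cis y \<notin> \<real>\<^sub>\<le>\<^sub>0"
    and "norm (1 - cis y) \<le> 2 * norm (1 - of_real r * cis y)"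
    and "norm (1 - of_real r * cis y) \<le> 2"
proof -
  have 1: "1 - r \<le> Re (1 - of_real r * cis y)"
    using mult_left_mono[OF cos_le_one[of y] assms(1)] by simp
  thus "1 - of_real r * cis y \<notin> \<real>\<^sub>\<le>\<^sub>0"
    using assms by (auto simp: complex_nonpos_Reals_iff)
  have "norm (1 - cis y) \<le> norm (1 - of_real r * cis y) + norm (of_real (1 - r) * cis y)"
    using norm_triangle_ineq4[of "1 - of_real r * cis y" "of_real (1 - r) * cis y"]
    by (simp add: algebra_simps)
  also have "norm (of_real (1 - r) * cis y) \<le> norm (1 - of_real r * cis y)"
    using assms 1 complex_Re_le_cmod[of "1 - of_real r * cis y"] by (simp add: norm_mult del: of_real_diff)
  finally show "norm (1 - cis y) \<le> 2 * norm (1 - of_real r * cis y)" by simp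
  have "norm (1 - of_real r * cis y) \<le> norm (1::complex) + norm (of_real r * cis y)"
    by (rule norm_triangle_ineq4)
  thus "norm (1 - of_real r * cis y) \<le> 2"
    using assms by (simp add: norm_mult)
qed

text \<open>Abel summation: at radius r < 1 the binomial series converges absolutely and is
  integrated termwise; the hypothesis supplies a majorant independent of r, so both sides pass to
  the limit. A general exponent lets -1/2 and 1/2 share the argument.\<close>

lemma integral_one_minus_cis_powr:
  fixes a :: complex
  assumes bound: "\<And>r x. 0 \<le> r \<Longrightarrow> r < 1 \<Longrightarrow> x \<in> punctured \<Longrightarrow>
    norm ((1 - of_real r * cis (- 2 * x)) powr a) \<le> B / sqrt \<bar>sin x\<bar>"
  shows "integral punctured (\<lambda>x. (1 - cis (- 2 * x)) powr a * cis (- of_int m * x)) =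
    2 * of_real pi * (if m \<le> 0 \<and> even m
      then (a gchoose nat (- m div 2)) * (-1) ^ nat (- m div 2) else 0)"
proof -
  define r :: "nat \<Rightarrow> real" where "r = (\<lambda>j. 1 - inverse (real (Suc (Suc j))))"
  have r: "0 \<le> r j" "r j < 1" for j
    by (simp_all add: r_def field_simps)
  have r_lim: "r \<longlonglongrightarrow> 1"
    unfolding r_def
    by (rule tendsto_eq_intros LIMSEQ_Suc[OF LIMSEQ_inverse_real_of_nat] refl | simp)+
  define f where "f = (\<lambda>j x. (1 - of_real (r j) * cis (- 2 * x)) powr a * cis (- of_int m * x))"
  have lim: "(\<lambda>j. integral punctured (f j)) \<longlonglongrightarrow>
      integral punctured (\<lambda>x. (1 - cis (- 2 * x)) powr a * cis (- of_int m * x))"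
  proof (rule dominated_convergence(2))
    show le: "norm (f j x) \<le> B * (1 / sqrt \<bar>sin x\<bar>)" if "x \<in> punctured" for j x
      using bound[OF r that] by (simp add: f_def norm_mult)
    show "f j integrable_on punctured" for j
    proof (rule integrable_of_bound(1))
      show "continuous_on punctured (f j)"
        unfolding f_def
      proof (rule continuous_on_mult)
        show "continuous_on punctured (\<lambda>x. cis (- of_int m * x))"
          by (intro continuous_intros)
        have "continuous_on punctured (\<lambda>x. 1 - of_real (r j) * cis (- 2 * x))"
          by (intro continuous_intros)
        thus "continuous_on punctured (\<lambda>x. (1 - of_real (r j) * cis (- 2 * x)) powr a)"
          unfolding continuous_on_def using scaled_one_minus_cis(1)[OF r]
          by (intro ballI tendsto_powr_complex tendsto_const) simp_all
      qed
    qed (use le in auto)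
    show "(\<lambda>x. B * (1 / sqrt \<bar>sin x\<bar>)) integrable_on punctured"
      by (intro integrable_on_mult_right inverse_sqrt_sin_integrable)
    show "(\<lambda>j. f j x) \<longlonglongrightarrow> (1 - cis (- 2 * x)) powr a * cis (- of_int m * x)" if x: "x \<in> punctured" for x
    proof -
      have "(\<lambda>j. 1 - of_real (r j) * cis (- 2 * x)) \<longlonglongrightarrow> 1 - of_real 1 * cis (- 2 * x)"
        by (intro tendsto_intros r_lim)
      thus ?thesis
        unfolding f_def
        by (intro tendsto_mult tendsto_const tendsto_powr_complex) (use one_minus_cis_nonpos_Reals[OF x] in simp_all)
    qed
  qed
  have "integral punctured (f j) = 2 * of_real pi * (if m \<le> 0 \<and> even m
      then (a gchoose nat (- m div 2)) * (- of_real (r j)) ^ nat (- m div 2) else 0)" for j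
  proof -
    \<comment> \<open>Convergence at the larger radius \<open>q\<close> < 1 yields absolute
      convergence at \<open>r j\<close>.\<close>
    define q where "q = (1 + r j) / 2"
    have q: "r j < q" "q < 1" "0 \<le> q" using r[of j] by (simp_all add: q_def)
    have "summable (\<lambda>n. (a gchoose n) * complex_of_real q ^ n)"
      by (rule sums_summable[OF gen_binomial_complex]) (use q in simp)
    hence "summable (\<lambda>n. norm ((a gchoose n) * (- complex_of_real (r j)) ^ n))"
      by (rule powser_insidea) (use q r[of j] in simp)
    from integral_absolutely_convergent_series[OF this]
    show ?thesis
    proof (rule subst[rotated, where P = "\<lambda>y. y = _"])
      have "(\<Sum>n. (a gchoose n) * (- complex_of_real (r j)) ^ n * cis (- 2 * x) ^ n) =
          (1 - of_real (r j) * cis (- 2 * x)) powr a" for x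
      proof -
        have "norm (- of_real (r j) * cis (- 2 * x)) < 1"
          using r[of j] by (simp add: norm_mult)
        from sums_unique[OF gen_binomial_complex[OF this, of a]] show ?thesis
          unfolding mult.assoc power_mult_distrib[symmetric] by simp
      qed
      thus "integral {-pi..pi} (\<lambda>x. (\<Sum>n. (a gchoose n) * (- complex_of_real (r j)) ^ n * cis (- 2 * x) ^ n)
          * cis (- of_int m * x)) = integral punctured (f j)"
        unfolding f_def by (simp only: integral_punctured)
    qed
  qed
  moreover have "(\<lambda>j. 2 * of_real pi * (if m \<le> 0 \<and> even m
      then (a gchoose nat (- m div 2)) * (- of_real (r j)) ^ nat (- m div 2) else 0))
    \<longlonglongrightarrow> 2 * of_real pi * (if m \<le> 0 \<and> even m
      then (a gchoose nat (- m div 2)) * (- of_real 1) ^ nat (- m div 2) else 0)"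
  proof (intro tendsto_mult tendsto_const)
    have "(\<lambda>j. (a gchoose n) * (- complex_of_real (r j)) ^ n) \<longlonglongrightarrow> (a gchoose n) * (- of_real 1) ^ n" for n
      by (intro tendsto_intros r_lim)
    thus "(\<lambda>j. if m \<le> 0 \<and> even m
        then (a gchoose nat (- m div 2)) * (- of_real (r j)) ^ nat (- m div 2) else 0)
      \<longlonglongrightarrow> (if m \<le> 0 \<and> even m
        then (a gchoose nat (- m div 2)) * (- of_real 1) ^ nat (- m div 2) else 0)"
      by (cases "m \<le> 0 \<and> even m") (simp_all only: if_True if_False simp_thms tendsto_const)
  qed
  ultimately show ?thesis
    using LIMSEQ_unique[OF lim] by (simp only: of_real_1)
qed

text \<open>From 2 |sin x| = |1 - e^{-2ix}| \<le> 2 |z| comes the lower bound on |z| that controls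
  exponent -1/2. The root itself is bounded; it is put under a singular majorant to fit the
  hypothesis of \<open>integral_one_minus_cis_powr\<close>.\<close>

lemma half_powr_bounds:
  fixes r x :: real
  assumes r: "0 \<le> r" "r < 1" and x: "x \<in> punctured"
  shows "norm ((1 - of_real r * cis (- 2 * x)) powr (- (1 / 2))) \<le> 1 / sqrt \<bar>sin x\<bar>"
    and "norm ((1 - of_real r * cis (- 2 * x)) powr (1 / 2)) \<le> 2 / sqrt \<bar>sin x\<bar>"
proof -
  let ?z = "1 - of_real r * cis (- 2 * x)"
  have s: "0 < \<bar>sin x\<bar>" "\<bar>sin x\<bar> \<le> 1"
    using sin_nonzero_punctured[OF x] by auto
  have z: "\<bar>sin x\<bar> \<le> norm ?z" "norm ?z \<le> 2"
    using scaled_one_minus_cis(2,3)[OF r, of "- 2 * x"] unfolding norm_one_minus_cis by simp_all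
  have h: "norm (?z powr (1 / 2)) = sqrt (norm ?z)"
    by (simp only: csqrt_conv_powr[symmetric] norm_csqrt)
  have "norm (?z powr (- (1 / 2))) = 1 / sqrt (norm ?z)"
    unfolding powr_minus norm_inverse h by (rule inverse_eq_divide)
  also have "\<dots> \<le> 1 / sqrt \<bar>sin x\<bar>"
    using s z by (intro divide_left_mono mult_pos_pos) auto
  finally show "norm (?z powr (- (1 / 2))) \<le> 1 / sqrt \<bar>sin x\<bar>" .
  have "sqrt (norm ?z) \<le> sqrt (2 ^ 2)"
    using z by (intro real_sqrt_le_mono) simp
  hence "norm (?z powr (1 / 2)) \<le> 2"
    unfolding h by simp
  also have "2 \<le> 2 / sqrt \<bar>sin x\<bar>"
    using s by (simp add: field_simps)
  finally show "norm (?z powr (1 / 2)) \<le> 2 / sqrt \<bar>sin x\<bar>" .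
qed

section \<open>Weighted Fourier coefficients\<close>

definition weight :: "real \<Rightarrow> complex" where
  "weight x = 1 / csqrt (1 - cis (- 2 * x))"

text \<open>The factor 1/(2 pi) is restored in \<open>hm_coeff\<close>. As a functional of the
  symbol \<open>\<phi>\<close>, the coefficient turns lattice operations in \<open>s\<close> into
  multiplications of the symbol.\<close>

definition wcoeff :: "(real \<Rightarrow> complex) \<Rightarrow> int \<Rightarrow> complex" where
  "wcoeff \<phi> s = integral punctured (\<lambda>x. \<phi> x * weight x * cis (- of_int s * x))"

lemma weight_powr: "weight x = (1 - cis (- 2 * x)) powr (- (1 / 2))"
  unfolding weight_def csqrt_conv_powr powr_minus by (rule inverse_eq_divide[symmetric])

lemma norm_weight_le:
  assumes "x \<in> punctured"
  shows "norm (weight x) \<le> 1 / sqrt \<bar>sin x\<bar>"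
proof -
  have s: "0 < \<bar>sin x\<bar>"
    using sin_nonzero_punctured[OF assms] by auto
  have "norm (weight x) = 1 / sqrt (2 * \<bar>sin x\<bar>)"
    unfolding weight_def norm_divide norm_csqrt norm_one_minus_cis by simp
  also have "\<dots> \<le> 1 / sqrt \<bar>sin x\<bar>"
    using s by (intro divide_left_mono mult_pos_pos) auto
  finally show ?thesis .
qed

lemma continuous_on_weight: "continuous_on punctured weight"
proof -
  have "continuous_on punctured (\<lambda>x. 1 - cis (- 2 * x))"
    by (intro continuous_intros)
  thus ?thesis
    unfolding weight_powr[abs_def] continuous_on_def using one_minus_cis_nonpos_Reals
    by (intro ballI tendsto_powr_complex tendsto_const) simp_all
qed

section \<open>Bounded continuous symbols and the calculus of their coefficients\<close>

definition bcont :: "(real \<Rightarrow> complex) \<Rightarrow> bool" where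
  "bcont \<phi> \<longleftrightarrow> continuous_on punctured \<phi> \<and> (\<exists>B. \<forall>x\<in>punctured. norm (\<phi> x) \<le> B)"

lemma bcontI: "continuous_on punctured \<phi> \<Longrightarrow> (\<And>x. x \<in> punctured \<Longrightarrow> norm (\<phi> x) \<le> B) \<Longrightarrow> bcont \<phi>"
  by (auto simp: bcont_def)

lemma bcont_add:
  assumes "bcont \<phi>" "bcont \<psi>"
  shows "bcont (\<lambda>x. \<phi> x + \<psi> x)"
proof -
  from assms obtain A B where "\<forall>x\<in>punctured. norm (\<phi> x) \<le> A" "\<forall>x\<in>punctured. norm (\<psi> x) \<le> B"
    by (auto simp: bcont_def)
  thus ?thesis
    using assms by (intro bcontI[of _ "A + B"] continuous_on_add norm_triangle_mono) (auto simp: bcont_def)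
qed

lemma bcont_mult:
  assumes "bcont \<phi>" "bcont \<psi>"
  shows "bcont (\<lambda>x. \<phi> x * \<psi> x)"
proof -
  from assms obtain A B where A: "\<forall>x\<in>punctured. norm (\<phi> x) \<le> A" and B: "\<forall>x\<in>punctured. norm (\<psi> x) \<le> B"
    by (auto simp: bcont_def)
  show ?thesis
  proof (rule bcontI[of _ "A * B"])
    show "norm (\<phi> x * \<psi> x) \<le> A * B" if "x \<in> punctured" for x
      unfolding norm_mult using A B that by (intro mult_mono) (auto intro: order_trans[OF norm_ge_zero])
  qed (use assms in \<open>auto simp: bcont_def intro: continuous_on_mult\<close>)
qed

lemma bcont_const: "bcont (\<lambda>_. c)"
  by (rule bcontI[of _ "norm c"]) auto

lemma bcont_cis: "bcont (\<lambda>x. cis (c * x))"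
  by (rule bcontI[of _ 1]) (auto intro!: continuous_intros)

lemma bcont_cos: "bcont (\<lambda>x. of_real (cos x))"
  by (rule bcontI[of _ 1]) (auto intro!: continuous_intros)

lemma bcont_power: "bcont \<phi> \<Longrightarrow> bcont (\<lambda>x. \<phi> x ^ n)"
  by (induction n) (auto intro: bcont_const bcont_mult)

lemma abs_Cfun_le_1: "\<bar>Cfun x\<bar> \<le> 1"
proof -
  have "\<bar>cos x\<bar> \<le> 1 + \<bar>sin x\<bar>" "0 < 1 + \<bar>sin x\<bar>"
    using abs_cos_le_one[of x] by linarith+
  thus ?thesis
    by (simp add: Cfun_def)
qed

lemma bcont_Cfun: "bcont (\<lambda>x. of_real (Cfun x))"
proof (rule bcontI[of _ 1])
  have "1 + \<bar>sin x\<bar> \<noteq> 0" for x :: real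
    using abs_ge_zero[of "sin x"] by linarith
  thus "continuous_on punctured (\<lambda>x. complex_of_real (Cfun x))"
    unfolding Cfun_def by (intro continuous_intros) auto
qed (simp add: abs_Cfun_le_1)

lemmas bcont_intros = bcont_add bcont_mult bcont_const bcont_cis bcont_cos bcont_power bcont_Cfun

lemma wcoeff_integrable:
  assumes "bcont \<phi>"
  shows "(\<lambda>x. \<phi> x * weight x * cis (- of_int s * x)) integrable_on punctured"
proof -
  from assms obtain B where B: "\<forall>x\<in>punctured. norm (\<phi> x) \<le> B"
    by (auto simp: bcont_def)
  show ?thesis
  proof (rule integrable_of_bound(1))
    show "norm (\<phi> x * weight x * cis (- of_int s * x)) \<le> B / sqrt \<bar>sin x\<bar>" if "x \<in> punctured" for x
      using mult_mono'[OF B[rule_format, OF that] norm_weight_le[OF that]] by (simp add: norm_mult)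
    show "continuous_on punctured (\<lambda>x. \<phi> x * weight x * cis (- of_int s * x))"
      using assms by (intro continuous_intros continuous_on_weight) (auto simp: bcont_def)
  qed
qed

lemma norm_wcoeff_le:
  assumes "bcont \<phi>" "\<And>x. x \<in> punctured \<Longrightarrow> norm (\<phi> x) \<le> B"
  shows "norm (wcoeff \<phi> s) \<le> B * integral punctured (\<lambda>x. 1 / sqrt \<bar>sin x\<bar>)"
  unfolding wcoeff_def
proof (rule integrable_of_bound(2))
  show "norm (\<phi> x * weight x * cis (- of_int s * x)) \<le> B / sqrt \<bar>sin x\<bar>" if "x \<in> punctured" for x
    using mult_mono'[OF assms(2)[OF that] norm_weight_le[OF that]] by (simp add: norm_mult)
  show "continuous_on punctured (\<lambda>x. \<phi> x * weight x * cis (- of_int s * x))"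
    using assms by (intro continuous_intros continuous_on_weight) (auto simp: bcont_def)
qed

lemma wcoeff_add:
  assumes "bcont \<phi>" "bcont \<psi>"
  shows "wcoeff (\<lambda>x. \<phi> x + \<psi> x) s = wcoeff \<phi> s + wcoeff \<psi> s"
  unfolding wcoeff_def using wcoeff_integrable assms
  by (simp add: distrib_right integral_add)

lemma wcoeff_cmult: "wcoeff (\<lambda>x. c * \<phi> x) s = c * wcoeff \<phi> s"
  unfolding wcoeff_def by (simp add: mult.assoc)

lemma wcoeff_diff:
  assumes "bcont \<phi>" "bcont \<psi>"
  shows "wcoeff (\<lambda>x. \<phi> x - \<psi> x) s = wcoeff \<phi> s - wcoeff \<psi> s"
  using wcoeff_add[OF assms(1) bcont_mult[OF bcont_const[of "-1"] assms(2)], of s]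
    wcoeff_cmult[of "-1" \<psi> s] by simp

text \<open>Because 2 cos x = e^{ix} + e^{-ix}, summing over the two horizontal shifts of
  \<open>s\<close> multiplies the symbol by 2 cos. Both harmonicity and decay rest on this.\<close>

lemma wcoeff_cos:
  assumes "bcont \<phi>"
  shows "wcoeff (\<lambda>x. 2 * of_real (cos x) * \<phi> x) s = wcoeff \<phi> (s - 1) + wcoeff \<phi> (s + 1)"
proof -
  have cos: "2 * of_real (cos x) * cis (- of_int s * x) =
      cis (- of_int (s - 1) * x) + cis (- of_int (s + 1) * x)" for x
  proof -
    have "2 * complex_of_real (cos x) = cis x + cis (- x)"
      by (simp add: complex_eq_iff)
    thus ?thesis
      by (simp add: distrib_right cis_mult algebra_simps)
  qed
  have "wcoeff \<phi> (s - 1) + wcoeff \<phi> (s + 1) = integral punctured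
      (\<lambda>x. \<phi> x * weight x * cis (- of_int (s - 1) * x) + \<phi> x * weight x * cis (- of_int (s + 1) * x))"
    unfolding wcoeff_def by (rule integral_add[symmetric]) (intro wcoeff_integrable assms)+
  also have "\<dots> = wcoeff (\<lambda>x. 2 * of_real (cos x) * \<phi> x) s"
    unfolding wcoeff_def distrib_left[symmetric] cos[symmetric] by (simp only: mult_ac)
  finally show ?thesis ..
qed

lemma wcoeff_one:
  "wcoeff (\<lambda>_. 1) s = 2 * of_real pi *
    (if s \<le> 0 \<and> even s then (- (1 / 2) gchoose nat (- s div 2)) * (-1) ^ nat (- s div 2) else 0)"
  using integral_one_minus_cis_powr[of "- (1 / 2)" 1 s] half_powr_bounds(1)
  by (simp add: wcoeff_def weight_powr)

text \<open>Since $|\sin x| = \frac12 |1 - e^{-2ix}|$, multiplying the weight by $|\sin x|$ turns it into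
  $\frac12\sqrt{1 - e^{2ix}}$, which has only Fourier modes of one sign.\<close>
lemma wcoeff_abs_sin:
  assumes "s < 0"
  shows "wcoeff (\<lambda>x. of_real \<bar>sin x\<bar>) s = 0"
proof -
  \<comment> \<open>Writing the integrand as a conjugate replaces e^{2ix} by e^{-2ix} and the
    frequency by -s > 0, where the series has no term. At s = 0 the constant term would
    survive.\<close>
  have "of_real \<bar>sin x\<bar> * weight x * cis (- of_int s * x) =
      cnj ((1 - cis (- 2 * x)) powr (1 / 2) * cis (- of_int (- s) * x)) * (1 / 2)" if "x \<in> punctured" for x
  proof -
    define c where "c = csqrt (1 - cis (- 2 * x))"
    have "c \<noteq> 0"
      using one_minus_cis_nonpos_Reals[OF that] by (auto simp: c_def)
    have "c * cnj c = of_real ((norm c)\<^sup>2)"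
      by (rule complex_norm_square[symmetric])
    also have "(norm c)\<^sup>2 = 2 * \<bar>sin x\<bar>"
      unfolding c_def norm_csqrt norm_one_minus_cis by simp
    finally have c: "of_real \<bar>sin x\<bar> * (1 / c) = cnj c * (1 / 2)"
      using \<open>c \<noteq> 0\<close> by (simp add: field_simps)
    have "of_real \<bar>sin x\<bar> * weight x * cis (- of_int s * x) = cnj c * (1 / 2) * cis (- of_int s * x)"
      unfolding weight_def c_def[symmetric] c ..
    also have "\<dots> = cnj (c * cis (- of_int (- s) * x)) * (1 / 2)"
      by (simp add: cis_cnj)
    finally show ?thesis
      unfolding c_def csqrt_conv_powr .
  qed
  hence "wcoeff (\<lambda>x. of_real \<bar>sin x\<bar>) s = integral punctured
      (\<lambda>x. cnj ((1 - cis (- 2 * x)) powr (1 / 2) * cis (- of_int (- s) * x)) * (1 / 2))"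
    unfolding wcoeff_def by (rule integral_cong)
  also have "\<dots> = cnj (integral punctured (\<lambda>x. (1 - cis (- 2 * x)) powr (1 / 2) * cis (- of_int (- s) * x))) * (1 / 2)"
    unfolding integral_cnj by (rule integral_mult_left)
  also have "\<dots> = 0"
    using integral_one_minus_cis_powr[of "1 / 2" 2 "- s"] half_powr_bounds(2) assms by simp
  finally show ?thesis .
qed

section \<open>Decay of the weighted coefficients\<close>

lemma gbinomial_of_real_complex: "(of_real a gchoose n :: complex) = of_real (a gchoose n)"
  by (simp add: gbinomial_prod_rev)

text \<open>The Taylor coefficients of (1 - z)^(-1/2), equal to binom(2n, n) / 4^n.\<close>

definition slit_coeff :: "nat \<Rightarrow> real" where
  "slit_coeff n = (- (1 / 2) gchoose n) * (-1) ^ n"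

lemma wcoeff_one_eq:
  "wcoeff (\<lambda>_. 1) s = of_real (2 * pi * (if s \<le> 0 \<and> even s then slit_coeff (nat (- s div 2)) else 0))"
proof -
  have "(- (1 / 2) gchoose n :: complex) = of_real (- (1 / 2) gchoose n)" for n
    using gbinomial_of_real_complex[of "- (1 / 2)" n] by simp
  thus ?thesis
    unfolding wcoeff_one slit_coeff_def by simp
qed

lemma slit_coeff_0: "slit_coeff 0 = 1"
  by (simp add: slit_coeff_def)

lemma slit_coeff_Suc: "slit_coeff (Suc n) = (real n + 1 / 2) / (real n + 1) * slit_coeff n"
  by (simp add: slit_coeff_def gbinomial_mult_1' gbinomial_Suc_rec field_simps)

text \<open>The general binomial asymptotics (-1)^n n^(-z-1) / Gamma(-z) at z = -1/2, where
  Gamma(1/2) = sqrt pi.\<close>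

lemma slit_coeff_asymp: "slit_coeff \<sim>[at_top] (\<lambda>n. 1 / sqrt (pi * real n))"
proof (rule asymp_equivI')
  have "(\<lambda>n. (- (1 / 2) gchoose n) / ((-1) ^ n / exp ((- (1 / 2) + 1) * of_real (ln (real n)))))
      \<longlonglongrightarrow> inverse (Gamma (1 / 2 :: real))"
    using gbinomial_asymptotic[of "- (1 / 2) :: real"] by simp
  hence "(\<lambda>n. (- (1 / 2) gchoose n) / ((-1) ^ n / exp ((- (1 / 2) + 1) * of_real (ln (real n)))) * sqrt pi)
      \<longlonglongrightarrow> inverse (sqrt pi) * sqrt pi"
    unfolding Gamma_one_half_real by (intro tendsto_mult tendsto_const)
  hence lim: "(\<lambda>n. (- (1 / 2) gchoose n) / ((-1) ^ n / exp ((- (1 / 2) + 1) * of_real (ln (real n)))) * sqrt pi)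
      \<longlonglongrightarrow> 1"
    by simp
  show "(\<lambda>n. slit_coeff n / (1 / sqrt (pi * real n))) \<longlonglongrightarrow> 1"
  proof (rule Lim_transform_eventually[OF lim])
    show "\<forall>\<^sub>F n in sequentially. (- (1 / 2) gchoose n) / ((-1) ^ n / exp ((- (1 / 2) + 1) * of_real (ln (real n)))) * sqrt pi
        = slit_coeff n / (1 / sqrt (pi * real n))"
      using eventually_gt_at_top[of 0]
    proof eventually_elim
      case (elim n)
      have "exp ((- (1 / 2) + 1) * of_real (ln (real n))) = sqrt (real n)"
        using elim by (simp add: powr_half_sqrt[symmetric] powr_def)
      moreover have "(-1) ^ n * (-1) ^ n = (1 :: real)"
        by (simp add: power_mult_distrib[symmetric])
      ultimately show ?case
        by (simp add: slit_coeff_def real_sqrt_mult divide_simps)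
    qed
  qed
qed

lemma slit_coeff_tendsto_0: "slit_coeff \<longlonglongrightarrow> 0"
proof -
  have "(\<lambda>n. 1 / sqrt (pi * real n)) \<longlonglongrightarrow> 0"
    by (rule real_tendsto_divide_at_top[OF tendsto_const] filterlim_compose[OF sqrt_at_top]
        filterlim_tendsto_pos_mult_at_top[OF tendsto_const pi_gt_zero] filterlim_real_sequentially)+
  thus ?thesis
    using tendsto_asymp_equiv_cong[OF slit_coeff_asymp] by blast
qed

section \<open>Decay along a single row\<close>

lemma tendsto_cofinite_inj:
  fixes g :: "'a \<Rightarrow> 'b"
  assumes "(f \<longlongrightarrow> l) cofinite" "inj g"
  shows "((\<lambda>x. f (g x)) \<longlongrightarrow> l) cofinite"
proof (rule filterlim_compose[OF assms(1)])
  show "filterlim g cofinite cofinite"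
    unfolding filterlim_iff eventually_cofinite
  proof (intro allI impI)
    fix P :: "'b \<Rightarrow> bool"
    assume "finite {x. \<not> P x}"
    from finite_vimageI[OF this assms(2)] show "finite {x. \<not> P (g x)}"
      by (simp add: vimage_def)
  qed
qed

lemma tendsto_norm_cofinite_iff:
  fixes f :: "'a \<Rightarrow> complex"
  shows "(f \<longlongrightarrow> 0) cofinite \<longleftrightarrow> (\<forall>e>0. finite {x. e \<le> norm (f x)})"
  by (simp add: tendsto_iff eventually_cofinite not_less)

lemma wcoeff_one_tendsto_0: "(wcoeff (\<lambda>_. 1) \<longlongrightarrow> 0) cofinite"
  unfolding tendsto_norm_cofinite_iff
proof (intro allI impI)
  fix e :: real assume "e > 0"
  hence "e / (2 * pi) > 0" by simp
  from LIMSEQ_D[OF slit_coeff_tendsto_0 this] obtain N where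
    N: "\<And>n. n \<ge> N \<Longrightarrow> norm (slit_coeff n) < e / (2 * pi)" by auto
  have "{s. e \<le> norm (wcoeff (\<lambda>_. 1) s)} \<subseteq> {- 2 * int N..0}"
  proof
    fix s assume "s \<in> {s. e \<le> norm (wcoeff (\<lambda>_. 1) s)}"
    hence s: "e \<le> norm (wcoeff (\<lambda>_. 1) s)" by simp
    hence "s \<le> 0 \<and> even s"
      using \<open>e > 0\<close> unfolding wcoeff_one_eq by (auto split: if_splits)
    moreover from this have "e \<le> 2 * pi * norm (slit_coeff (nat (- s div 2)))"
      using s unfolding wcoeff_one_eq norm_of_real by (simp add: abs_mult)
    hence "\<not> norm (slit_coeff (nat (- s div 2))) < e / (2 * pi)"
      by (simp add: field_simps)
    hence "nat (- s div 2) < N"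
      using N not_le by blast
    ultimately show "s \<in> {- 2 * int N..0}"
      by auto
  qed
  thus "finite {s. e \<le> norm (wcoeff (\<lambda>_. 1) s)}"
    by (rule finite_subset) simp
qed

text \<open>Multiplication by cos averages two shifts of the sequence. Shifts are injective, so
  decay along \<open>cofinite\<close>, that is at both ends of the integers, is inherited from the
  explicit case n = 0.\<close>

lemma wcoeff_cos_power_tendsto_0: "(wcoeff (\<lambda>x. of_real (cos x) ^ n) \<longlongrightarrow> 0) cofinite"
proof (induction n)
  case 0
  show ?case using wcoeff_one_tendsto_0 by simp
next
  case (Suc n)
  have eq: "wcoeff (\<lambda>x. of_real (cos x) ^ Suc n) = (\<lambda>s. 1 / 2 *
      (wcoeff (\<lambda>x. of_real (cos x) ^ n) (s - 1) + wcoeff (\<lambda>x. of_real (cos x) ^ n) (s + 1)))"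
  proof
    fix s
    have "2 * wcoeff (\<lambda>x. of_real (cos x) ^ Suc n) s = wcoeff (\<lambda>x. 2 * of_real (cos x) * of_real (cos x) ^ n) s"
      unfolding wcoeff_cmult[symmetric] by (simp add: mult.assoc)
    also have "\<dots> = wcoeff (\<lambda>x. of_real (cos x) ^ n) (s - 1) + wcoeff (\<lambda>x. of_real (cos x) ^ n) (s + 1)"
      by (intro wcoeff_cos bcont_intros)
    finally show "wcoeff (\<lambda>x. of_real (cos x) ^ Suc n) s = 1 / 2 *
      (wcoeff (\<lambda>x. of_real (cos x) ^ n) (s - 1) + wcoeff (\<lambda>x. of_real (cos x) ^ n) (s + 1))"
      by (simp add: field_simps)
  qed
  have "inj (\<lambda>s::int. s - 1)" "inj (\<lambda>s::int. s + 1)"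
    by (simp_all add: inj_def)
  from tendsto_add[OF this[THEN tendsto_cofinite_inj[OF Suc]]]
  have "((\<lambda>s. wcoeff (\<lambda>x. of_real (cos x) ^ n) (s - 1) + wcoeff (\<lambda>x. of_real (cos x) ^ n) (s + 1)) \<longlongrightarrow> 0) cofinite"
    by simp
  from tendsto_mult_left[OF this, of "1 / 2"] show ?case
    unfolding eq by simp
qed

lemma bcont_sum: "finite I \<Longrightarrow> (\<And>i. i \<in> I \<Longrightarrow> bcont (\<phi> i)) \<Longrightarrow> bcont (\<lambda>x. \<Sum>i\<in>I. \<phi> i x)"
  by (induction I rule: finite_induct) (auto intro: bcont_intros)

lemma wcoeff_sum:
  "finite I \<Longrightarrow> (\<And>i. i \<in> I \<Longrightarrow> bcont (\<phi> i)) \<Longrightarrow>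
    wcoeff (\<lambda>x. \<Sum>i\<in>I. \<phi> i x) s = (\<Sum>i\<in>I. wcoeff (\<phi> i) s)"
proof (induction I rule: finite_induct)
  case empty
  show ?case by (simp add: wcoeff_def)
next
  case (insert i I)
  thus ?case by (simp add: wcoeff_add bcont_sum)
qed

text \<open>A Riemann--Lebesgue lemma: $h(\cos x)$ is a uniform limit of polynomials in $\cos x$, whose
  coefficients are finite combinations of shifts of the explicit sequence for $h = 1$.\<close>
lemma wcoeff_compose_cos_tendsto_0:
  fixes h :: "real \<Rightarrow> real"
  assumes h: "continuous_on {-1..1} h"
  shows "(wcoeff (\<lambda>x. of_real (h (cos x))) \<longlongrightarrow> 0) cofinite"
  unfolding tendsto_norm_cofinite_iff
proof (intro allI impI)
  fix e :: real assume e: "e > 0"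
  define W where "W = integral punctured (\<lambda>x. 1 / sqrt \<bar>sin x\<bar>)"
  have W: "W \<ge> 0"
    unfolding W_def by (rule integral_nonneg[OF inverse_sqrt_sin_integrable]) simp
  \<comment> \<open>A uniform error d in the symbol moves a coefficient by at most d * W < e/2; the
    summand 1 covers W = 0.\<close>
  define d where "d = e / (2 * (W + 1))"
  have d: "d > 0" "d * W < e / 2"
    using e W by (simp_all add: d_def field_simps)
  obtain p where "real_polynomial_function p" and p: "\<And>y. y \<in> {-1..1} \<Longrightarrow> \<bar>h y - p y\<bar> < d"
    using Stone_Weierstrass_real_polynomial_function[OF compact_Icc h d(1)] by blast
  then obtain a n where p_eq: "p = (\<lambda>y. \<Sum>i\<le>n. a i * y ^ i)"
    by (auto simp: real_polynomial_function_iff_sum)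
  let ?h = "\<lambda>x. complex_of_real (h (cos x))"
  let ?p = "\<lambda>x. \<Sum>i\<le>n. complex_of_real (a i) * of_real (cos x) ^ i"
  have bp: "bcont ?p"
    by (intro bcont_sum bcont_intros) simp
  have close: "norm (?h x - ?p x) \<le> d" for x
  proof -
    have "?h x - ?p x = of_real (h (cos x) - p (cos x))"
      by (simp add: p_eq)
    thus ?thesis
      using p[of "cos x"] by (simp only: norm_of_real) simp
  qed
  have bh: "bcont ?h"
  proof -
    have c: "continuous_on punctured ?h"
      by (intro continuous_on_of_real continuous_on_compose2[OF h] continuous_intros) auto
    from bp obtain B where B: "\<forall>x\<in>punctured. norm (?p x) \<le> B"
      by (auto simp: bcont_def)
    have "norm (?h x) \<le> d + B" if "x \<in> punctured" for x
      using norm_triangle_mono[OF close[of x] B[rule_format, OF that]] by simp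
    thus ?thesis by (rule bcontI[OF c])
  qed
  have diff: "norm (wcoeff ?h s - wcoeff ?p s) < e / 2" for s
  proof -
    have "bcont (\<lambda>x. ?h x - ?p x)"
      using bcont_add[OF bh bcont_mult[OF bcont_const[of "-1"] bp]] by simp
    from norm_wcoeff_le[OF this close, of s] d(2) show ?thesis
      by (simp add: wcoeff_diff bh bp W_def)
  qed
  have "((\<lambda>s. \<Sum>i\<le>n. of_real (a i) * wcoeff (\<lambda>x. of_real (cos x) ^ i) s) \<longlongrightarrow> (\<Sum>i\<le>n. of_real (a i) * 0)) cofinite"
    by (intro tendsto_sum tendsto_mult tendsto_const wcoeff_cos_power_tendsto_0)
  moreover have "wcoeff ?p = (\<lambda>s. \<Sum>i\<le>n. of_real (a i) * wcoeff (\<lambda>x. of_real (cos x) ^ i) s)"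
    by (intro ext, subst wcoeff_sum) (auto simp: wcoeff_cmult intro!: bcont_intros)
  ultimately have "(wcoeff ?p \<longlongrightarrow> 0) cofinite"
    by simp
  hence fin: "finite {s. e / 2 \<le> norm (wcoeff ?p s)}"
    using half_gt_zero[OF e] unfolding tendsto_norm_cofinite_iff by blast
  show "finite {s. e \<le> norm (wcoeff ?h s)}"
  proof (rule finite_subset[OF _ fin], safe)
    fix s assume "e \<le> norm (wcoeff ?h s)"
    also have "\<dots> \<le> norm (wcoeff ?p s) + norm (wcoeff ?h s - wcoeff ?p s)"
      using norm_triangle_ineq[of "wcoeff ?p s" "wcoeff ?h s - wcoeff ?p s"] by simp
    finally show "e / 2 \<le> norm (wcoeff ?p s)"
      using diff[of s] by linarith
  qed
qed

text \<open>Since |sin x| = sqrt (1 - cos^2 x), \<open>Cfun\<close> is y / (1 + sqrt (1 - y^2)) at y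
  = cos x, which is continuous on all of [-1, 1].\<close>

lemma wcoeff_Cfun_power_tendsto_0: "(wcoeff (\<lambda>x. of_real (Cfun x) ^ n) \<longlongrightarrow> 0) cofinite"
proof -
  let ?h = "\<lambda>y. (y / (1 + sqrt (1 - y\<^sup>2))) ^ n"
  have "1 + sqrt (1 - y\<^sup>2) \<noteq> 0" if "y \<in> {-1..1}" for y :: real
  proof -
    have "y\<^sup>2 \<le> 1" using that by (simp add: abs_square_le_1 abs_le_iff)
    hence "sqrt (1 - y\<^sup>2) \<ge> 0" by simp
    thus ?thesis by linarith
  qed
  hence "continuous_on {-1..1} ?h"
    by (intro continuous_intros) blast
  from wcoeff_compose_cos_tendsto_0[OF this]
  show ?thesis
    by (simp add: Cfun_def sin_squared_eq[symmetric])
qed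

text \<open>Taking norms under the integral removes \<open>s\<close>. On \<open>punctured\<close>
  |C| < 1 strictly, so the remaining integrals tend to 0 by dominated convergence.\<close>

lemma wcoeff_Cfun_power_uniform:
  assumes "e > 0"
  shows "\<exists>K. \<forall>k\<ge>K. \<forall>s. norm (wcoeff (\<lambda>x. of_real (Cfun x) ^ k) s) < e"
proof -
  define I where "I = (\<lambda>k. integral punctured (\<lambda>x. \<bar>Cfun x\<bar> ^ k / sqrt \<bar>sin x\<bar>))"
  have le: "\<bar>Cfun x\<bar> ^ k / sqrt \<bar>sin x\<bar> \<le> 1 / sqrt \<bar>sin x\<bar>" for x k
    using abs_Cfun_le_1[of x] by (intro divide_right_mono power_le_one) auto
  have den: "1 + \<bar>sin x\<bar> \<noteq> 0" for x :: real
    using abs_ge_zero[of "sin x"] by linarith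
  have int: "(\<lambda>x. \<bar>Cfun x\<bar> ^ k / sqrt \<bar>sin x\<bar>) integrable_on punctured" for k
  proof (rule measurable_bounded_by_integrable_imp_integrable_real[OF _ inverse_sqrt_sin_integrable])
    show "(\<lambda>x. \<bar>Cfun x\<bar> ^ k / sqrt \<bar>sin x\<bar>) \<in> borel_measurable (lebesgue_on punctured)"
      unfolding Cfun_def
      by (intro continuous_imp_measurable_on_sets_lebesgue continuous_intros punctured_lebesgue)
        (use den sin_nonzero_punctured in auto)
  qed (use le punctured_lebesgue in auto)
  have "I \<longlonglongrightarrow> integral punctured (\<lambda>x. 0)"
    unfolding I_def
  proof (rule dominated_convergence(2)[OF int inverse_sqrt_sin_integrable])
    show "norm (\<bar>Cfun x\<bar> ^ k / sqrt \<bar>sin x\<bar>) \<le> 1 / sqrt \<bar>sin x\<bar>" for k x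
      using le[of x k] by simp
    show "(\<lambda>k. \<bar>Cfun x\<bar> ^ k / sqrt \<bar>sin x\<bar>) \<longlonglongrightarrow> 0" if "x \<in> punctured" for x
    proof -
      have "\<bar>cos x\<bar> < 1 + \<bar>sin x\<bar>"
        using sin_nonzero_punctured[OF that] abs_cos_le_one[of x] zero_less_abs_iff[of "sin x"] by linarith
      hence "\<bar>Cfun x\<bar> < 1"
        by (simp add: Cfun_def)
      hence "(\<lambda>k. \<bar>Cfun x\<bar> ^ k / sqrt \<bar>sin x\<bar>) \<longlonglongrightarrow> 0 / sqrt \<bar>sin x\<bar>"
        by (intro tendsto_divide LIMSEQ_power_zero tendsto_const) (use sin_nonzero_punctured[OF that] in auto)
      thus ?thesis by simp
    qed
  qed
  from LIMSEQ_D[OF this[unfolded integral_0] assms]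
  obtain K where K: "\<And>k. k \<ge> K \<Longrightarrow> \<bar>I k\<bar> < e" by auto
  have "norm (wcoeff (\<lambda>x. of_real (Cfun x) ^ k) s) \<le> I k" for k s
    unfolding wcoeff_def I_def
  proof (rule integral_norm_bound_integral[OF wcoeff_integrable int])
    show "bcont (\<lambda>x. of_real (Cfun x) ^ k)" by (intro bcont_intros)
    show "norm (of_real (Cfun x) ^ k * weight x * cis (- of_int s * x)) \<le> \<bar>Cfun x\<bar> ^ k / sqrt \<bar>sin x\<bar>"
      if "x \<in> punctured" for x
      using mult_left_mono[OF norm_weight_le[OF that], of "\<bar>Cfun x\<bar> ^ k"] by (simp add: norm_mult norm_power)
  qed
  thus ?thesis
    using K by (meson abs_ge_self le_less_trans)
qed

section \<open>The Dirichlet problem on the slit lattice\<close>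

text \<open>Integer coordinates free the maximum principle from the mesh size. Boundary values are
  left out so that the class is closed under differences; decay is encoded as finiteness of
  superlevel sets of |u|, which is what makes a maximum exist.\<close>

definition slit_harmonic :: "(int \<Rightarrow> int \<Rightarrow> real) \<Rightarrow> bool" where
  "slit_harmonic u \<longleftrightarrow>
    (\<forall>s k. even (s + k) \<and> \<not> (k = 0 \<and> 0 \<le> s) \<longrightarrow>
      u (s + 1) (k + 1) + u (s + 1) (k - 1) + u (s - 1) (k - 1) + u (s - 1) (k + 1) = 4 * u s k) \<and>
    (\<forall>e>0. finite {(s, k). even (s + k) \<and> e \<le> \<bar>u s k\<bar>})"

lemma slit_harmonicD:
  assumes "slit_harmonic u"
  shows "even (s + k) \<Longrightarrow> \<not> (k = 0 \<and> 0 \<le> s) \<Longrightarrow>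
      u (s + 1) (k + 1) + u (s + 1) (k - 1) + u (s - 1) (k - 1) + u (s - 1) (k + 1) = 4 * u s k"
    and "e > 0 \<Longrightarrow> finite {(s, k). even (s + k) \<and> e \<le> \<bar>u s k\<bar>}"
proof -
  note u = assms[unfolded slit_harmonic_def]
  show "even (s + k) \<Longrightarrow> \<not> (k = 0 \<and> 0 \<le> s) \<Longrightarrow>
      u (s + 1) (k + 1) + u (s + 1) (k - 1) + u (s - 1) (k - 1) + u (s - 1) (k + 1) = 4 * u s k"
    by (rule u[THEN conjunct1, rule_format]) (rule conjI)
  show "e > 0 \<Longrightarrow> finite {(s, k). even (s + k) \<and> e \<le> \<bar>u s k\<bar>}"
    by (rule u[THEN conjunct2, rule_format])
qed

lemma slit_harmonic_diff:
  assumes u: "slit_harmonic u" and v: "slit_harmonic v"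
  shows "slit_harmonic (\<lambda>s k. u s k - v s k)"
  unfolding slit_harmonic_def
proof (intro conjI allI impI)
  fix s k :: int assume "even (s + k) \<and> \<not> (k = 0 \<and> 0 \<le> s)"
  hence sk: "even (s + k)" "\<not> (k = 0 \<and> 0 \<le> s)" by blast+
  show "u (s + 1) (k + 1) - v (s + 1) (k + 1) + (u (s + 1) (k - 1) - v (s + 1) (k - 1)) +
      (u (s - 1) (k - 1) - v (s - 1) (k - 1)) + (u (s - 1) (k + 1) - v (s - 1) (k + 1)) = 4 * (u s k - v s k)"
    using slit_harmonicD(1)[OF u sk] slit_harmonicD(1)[OF v sk] by (simp add: algebra_simps)
next
  fix e :: real assume "e > 0"
  hence "e / 2 > 0" by simp
  from finite_UnI[OF slit_harmonicD(2)[OF u this] slit_harmonicD(2)[OF v this]]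
  show "finite {(s, k). even (s + k) \<and> e \<le> \<bar>u s k - v s k\<bar>}"
    by (rule rev_finite_subset) auto
qed

text \<open>Decay makes a positive maximum attained, and only at finitely many points. Off the slit
  every neighbour of a maximiser is a maximiser, so one with largest k is contradicted by (s + 1, k
  + 1). This choice replaces following a path to the slit.\<close>

lemma slit_harmonic_le_0:
  assumes u: "slit_harmonic u"
    and zero: "\<And>s. 0 \<le> s \<Longrightarrow> even s \<Longrightarrow> u s 0 = 0"
    and even: "even (s0 + k0)"
  shows "u s0 k0 \<le> 0"
proof (rule ccontr)
  assume "\<not> u s0 k0 \<le> 0"
  hence pos: "0 < u s0 k0" by simp
  \<comment> \<open>The superlevel set of the positive value to be excluded: finite by decay, and
    outside it \<open>u\<close> is smaller, so the maximum over it is global.\<close>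
  define A where "A = {(s, k). even (s + k) \<and> u s0 k0 \<le> u s k}"
  have "finite {(s, k). even (s + k) \<and> u s0 k0 \<le> \<bar>u s k\<bar>}"
    by (rule slit_harmonicD(2)[OF u pos])
  hence finA: "finite A"
    by (rule rev_finite_subset) (auto simp: A_def)
  have "(s0, k0) \<in> A"
    using even by (simp add: A_def)
  define M where "M = Max ((\<lambda>(s, k). u s k) ` A)"
  have le_M: "u s k \<le> M" if "even (s + k)" for s k
  proof -
    have A: "u s k \<le> M" if "(s, k) \<in> A" for s k
      unfolding M_def using finA that by (intro Max_ge) force+
    show ?thesis
      using A[of s k] A[OF \<open>(s0, k0) \<in> A\<close>] that by (cases "(s, k) \<in> A") (auto simp: A_def)
  qed
  define B where "B = {(s, k) \<in> A. u s k = M}"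
  have finB: "finite B"
    using finA by (rule rev_finite_subset) (auto simp: B_def)
  have "M \<in> (\<lambda>(s, k). u s k) ` A"
    unfolding M_def using finA \<open>(s0, k0) \<in> A\<close> by (intro Max_in) auto
  hence "B \<noteq> {}"
    by (auto simp: B_def)
  hence "Max (snd ` B) \<in> snd ` B"
    using finB by (intro Max_in) auto
  then obtain s k where sk: "(s, k) \<in> B" and k: "k = Max (snd ` B)"
    by auto
  have e: "even (s + k)" and M: "u s k = M" and "u s0 k0 \<le> u s k"
    using sk by (auto simp: A_def B_def)
  \<comment> \<open>A slit point would have value 0, below the positive
    \<open>u s0 k0\<close>.\<close>
  have "\<not> (k = 0 \<and> 0 \<le> s)"
    using zero[of s] pos \<open>u s0 k0 \<le> u s k\<close> e by auto
  with e have "u (s + 1) (k + 1) + u (s + 1) (k - 1) + u (s - 1) (k - 1) + u (s - 1) (k + 1) = 4 * u s k"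
    by (rule slit_harmonicD(1)[OF u])
  moreover have "u (s + 1) (k + 1) \<le> M" "u (s + 1) (k - 1) \<le> M" "u (s - 1) (k - 1) \<le> M" "u (s - 1) (k + 1) \<le> M"
    using e by (intro le_M; simp)+
  ultimately have "u (s + 1) (k + 1) = M"
    using M by linarith
  hence "(s + 1, k + 1) \<in> B"
    using e M \<open>u s0 k0 \<le> u s k\<close> by (simp add: A_def B_def)
  hence "k + 1 \<le> k"
  proof -
    have "k + 1 \<in> snd ` B"
      using imageI[OF \<open>(s + 1, k + 1) \<in> B\<close>, of snd] by (simp only: snd_conv)
    thus ?thesis
      unfolding k by (intro Max_ge finite_imageI finB)
  qed
  thus False by simp
qed

lemma slit_harmonic_eq_0:
  assumes "slit_harmonic u" "\<And>s. 0 \<le> s \<Longrightarrow> even s \<Longrightarrow> u s 0 = 0" "even (s + k)"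
  shows "u s k = 0"
proof -
  have "slit_harmonic (\<lambda>s k. 0)"
    by (simp add: slit_harmonic_def)
  hence "slit_harmonic (\<lambda>s k. 0 - u s k)"
    using assms(1) by (rule slit_harmonic_diff)
  hence "0 - u s k \<le> 0"
    by (rule slit_harmonic_le_0) (simp_all add: assms(2) assms(3) del: even_add)
  moreover have "u s k \<le> 0"
    using assms by (rule slit_harmonic_le_0)
  ultimately show ?thesis by simp
qed

section \<open>Translation between complex lattice points and integer coordinates\<close>

definition lattice_point :: "real \<Rightarrow> int \<Rightarrow> int \<Rightarrow> complex" where
  "lattice_point \<delta> s k = complex_of_real \<delta> * (of_int s + \<i> * of_int k)"

lemma Re_lattice_point [simp]: "Re (lattice_point \<delta> s k) = \<delta> * of_int s"
  and Im_lattice_point [simp]: "Im (lattice_point \<delta> s k) = \<delta> * of_int k"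
  by (simp_all add: lattice_point_def)

lemma lattice_altdef: "lattice \<delta> = {lattice_point \<delta> s k | s k. even (s + k)}"
  by (simp add: lattice_def lattice_point_def)

lemma lattice_point_in_slit_iff:
  assumes "\<delta> > 0"
  shows "lattice_point \<delta> s k \<in> slit \<delta> \<longleftrightarrow> k = 0 \<and> 0 \<le> s \<and> even s"
proof
  assume "lattice_point \<delta> s k \<in> slit \<delta>"
  then obtain j :: nat where j: "lattice_point \<delta> s k = complex_of_real (2 * real j * \<delta>)"
    by (auto simp: slit_def)
  from arg_cong[OF j, of Im] arg_cong[OF j, of Re] assms
  have "k = 0" "real_of_int s = 2 * real j"
    by (simp_all add: mult.commute)
  hence "s = 2 * int j" by linarith
  with \<open>k = 0\<close> show "k = 0 \<and> 0 \<le> s \<and> even s" by simp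
next
  assume "k = 0 \<and> 0 \<le> s \<and> even s"
  then obtain j where "s = 2 * j" "0 \<le> j" "k = 0"
    by (auto elim!: evenE)
  hence "lattice_point \<delta> s k = complex_of_real (2 * real (nat j) * \<delta>)"
    by (simp add: lattice_point_def)
  thus "lattice_point \<delta> s k \<in> slit \<delta>"
    unfolding slit_def by blast
qed

lemma slit_altdef:
  assumes "\<delta> > 0"
  shows "slit \<delta> = {lattice_point \<delta> s 0 | s. 0 \<le> s \<and> even s}"
proof
  show "slit \<delta> \<subseteq> {lattice_point \<delta> s 0 | s. 0 \<le> s \<and> even s}"
  proof
    fix z assume "z \<in> slit \<delta>"
    then obtain j :: nat where "z = complex_of_real (2 * real j * \<delta>)"
      by (auto simp: slit_def)
    hence "z = lattice_point \<delta> (2 * int j) 0"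
      by (simp add: lattice_point_def)
    thus "z \<in> {lattice_point \<delta> s 0 | s. 0 \<le> s \<and> even s}"
      by (intro CollectI exI[of _ "2 * int j"]) simp
  qed
qed (auto simp: lattice_point_in_slit_iff[OF assms])

lemma discrete_harmonic_at_lattice_point:
  "discrete_harmonic_at \<delta> f (lattice_point \<delta> s k) \<longleftrightarrow>
    f (lattice_point \<delta> (s + 1) (k + 1)) + f (lattice_point \<delta> (s + 1) (k - 1))
    + f (lattice_point \<delta> (s - 1) (k - 1)) + f (lattice_point \<delta> (s - 1) (k + 1)) = 4 * f (lattice_point \<delta> s k)"
proof -
  have "lattice_point \<delta> s k + (1 + \<i>) * complex_of_real \<delta> = lattice_point \<delta> (s + 1) (k + 1)"
    "lattice_point \<delta> s k + (1 - \<i>) * complex_of_real \<delta> = lattice_point \<delta> (s + 1) (k - 1)"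
    "lattice_point \<delta> s k - (1 + \<i>) * complex_of_real \<delta> = lattice_point \<delta> (s - 1) (k - 1)"
    "lattice_point \<delta> s k - (1 - \<i>) * complex_of_real \<delta> = lattice_point \<delta> (s - 1) (k + 1)"
    by (simp_all add: complex_eq_iff algebra_simps)
  thus ?thesis
    by (simp only: discrete_harmonic_at_def)
qed

text \<open>A disc contains finitely many lattice points, and finitely many points lie in a
  disc.\<close>

lemma lattice_decay_iff:
  fixes f :: "complex \<Rightarrow> real"
  assumes \<delta>: "\<delta> > 0"
  shows "(\<exists>R. \<forall>z\<in>lattice \<delta>. norm z > R \<longrightarrow> \<bar>f z\<bar> < e) \<longleftrightarrow>
    finite {(s, k). even (s + k) \<and> e \<le> \<bar>f (lattice_point \<delta> s k)\<bar>}" (is "?L \<longleftrightarrow> finite ?A")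
proof
  assume ?L
  then obtain R where R: "\<And>z. z \<in> lattice \<delta> \<Longrightarrow> norm z > R \<Longrightarrow> \<bar>f z\<bar> < e" by blast
  have "?A \<subseteq> {- \<lfloor>R / \<delta>\<rfloor>..\<lfloor>R / \<delta>\<rfloor>} \<times> {- \<lfloor>R / \<delta>\<rfloor>..\<lfloor>R / \<delta>\<rfloor>}"
  proof safe
    fix s k :: int assume sk: "even (s + k)" "e \<le> \<bar>f (lattice_point \<delta> s k)\<bar>"
    hence "norm (lattice_point \<delta> s k) \<le> R"
      using R[of "lattice_point \<delta> s k"] by (auto simp: lattice_altdef not_le[symmetric])
    hence "\<bar>\<delta> * of_int s\<bar> \<le> R" "\<bar>\<delta> * of_int k\<bar> \<le> R"
      using abs_Re_le_cmod[of "lattice_point \<delta> s k"] abs_Im_le_cmod[of "lattice_point \<delta> s k"] by simp_all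
    hence "of_int \<bar>s\<bar> \<le> R / \<delta>" "of_int \<bar>k\<bar> \<le> R / \<delta>"
      using \<delta> by (simp_all add: abs_mult field_simps)
    hence "\<bar>s\<bar> \<le> \<lfloor>R / \<delta>\<rfloor>" "\<bar>k\<bar> \<le> \<lfloor>R / \<delta>\<rfloor>"
      by (simp_all only: le_floor_iff)
    thus "s \<in> {- \<lfloor>R / \<delta>\<rfloor>..\<lfloor>R / \<delta>\<rfloor>}" "k \<in> {- \<lfloor>R / \<delta>\<rfloor>..\<lfloor>R / \<delta>\<rfloor>}"
      by auto
  qed
  thus "finite ?A"
    by (rule finite_subset) simp
next
  assume "finite ?A"
  hence "bounded ((\<lambda>(s, k). lattice_point \<delta> s k) ` ?A)"
    by (intro finite_imp_bounded finite_imageI)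
  then obtain R where R: "\<And>z. z \<in> (\<lambda>(s, k). lattice_point \<delta> s k) ` ?A \<Longrightarrow> norm z \<le> R"
    unfolding bounded_iff by blast
  show ?L
  proof (intro exI[of _ R] ballI impI)
    fix z assume "z \<in> lattice \<delta>" "R < norm z"
    then obtain s k where z: "z = lattice_point \<delta> s k" "even (s + k)"
      by (auto simp: lattice_altdef)
    have "(s, k) \<notin> ?A"
      using R[of z] \<open>R < norm z\<close> z(1) by force
    thus "\<bar>f z\<bar> < e"
      using z by simp
  qed
qed

lemma is_hm_iff:
  assumes \<delta>: "\<delta> > 0"
  shows "is_hm \<delta> f \<longleftrightarrow> slit_harmonic (\<lambda>s k. f (lattice_point \<delta> s k)) \<and>
    (\<forall>s\<ge>0. even s \<longrightarrow> f (lattice_point \<delta> s 0) = (if s = 0 then 1 else 0)) \<and>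
    (\<forall>z. z \<notin> lattice \<delta> \<longrightarrow> f z = 0)"
proof -
  have harm: "(\<forall>z\<in>lattice \<delta> - slit \<delta>. discrete_harmonic_at \<delta> f z) \<longleftrightarrow>
    (\<forall>s k. even (s + k) \<and> \<not> (k = 0 \<and> 0 \<le> s) \<longrightarrow> discrete_harmonic_at \<delta> f (lattice_point \<delta> s k))"
  proof (intro iffI allI ballI impI)
    fix s k :: int
    assume *: "\<forall>z\<in>lattice \<delta> - slit \<delta>. discrete_harmonic_at \<delta> f z"
      and sk: "even (s + k) \<and> \<not> (k = 0 \<and> 0 \<le> s)"
    have "lattice_point \<delta> s k \<in> lattice \<delta> - slit \<delta>"
      using sk unfolding lattice_altdef Diff_iff lattice_point_in_slit_iff[OF \<delta>] by blast
    with * show "discrete_harmonic_at \<delta> f (lattice_point \<delta> s k)" by blast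
  next
    fix z assume *: "\<forall>s k. even (s + k) \<and> \<not> (k = 0 \<and> 0 \<le> s) \<longrightarrow> discrete_harmonic_at \<delta> f (lattice_point \<delta> s k)"
      and z: "z \<in> lattice \<delta> - slit \<delta>"
    then obtain s k where sk: "z = lattice_point \<delta> s k" "even (s + k)"
      by (auto simp: lattice_altdef)
    hence "\<not> (k = 0 \<and> 0 \<le> s)"
      using z lattice_point_in_slit_iff[OF \<delta>, of s k] by auto
    with * sk show "discrete_harmonic_at \<delta> f z" by blast
  qed
  have origin: "lattice_point \<delta> 0 0 = 0" "lattice_point \<delta> s 0 = 0 \<longleftrightarrow> s = 0" for s :: int
    using \<delta> by (simp_all add: lattice_point_def)
  have bdry: "(f 0 = 1 \<and> (\<forall>z\<in>slit \<delta> - {0}. f z = 0)) \<longleftrightarrow>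
    (\<forall>s\<ge>0. even s \<longrightarrow> f (lattice_point \<delta> s 0) = (if s = 0 then 1 else 0))"
  proof (intro iffI allI impI conjI ballI)
    fix s :: int
    assume *: "f 0 = 1 \<and> (\<forall>z\<in>slit \<delta> - {0}. f z = 0)" and s: "0 \<le> s" "even s"
    hence "lattice_point \<delta> s 0 \<in> slit \<delta>"
      by (simp add: lattice_point_in_slit_iff[OF \<delta>])
    show "f (lattice_point \<delta> s 0) = (if s = 0 then 1 else 0)"
    proof (cases "s = 0")
      case True
      show ?thesis
        unfolding True origin(1) using * by simp
    next
      case False
      hence "lattice_point \<delta> s 0 \<in> slit \<delta> - {0}"
        using \<open>lattice_point \<delta> s 0 \<in> slit \<delta>\<close> origin(2)[of s] by blast
      with * have "f (lattice_point \<delta> s 0) = 0" by blast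
      with False show ?thesis by simp
    qed
  next
    assume *: "\<forall>s\<ge>0. even s \<longrightarrow> f (lattice_point \<delta> s 0) = (if s = 0 then 1 else 0)"
    thus "f 0 = 1" using origin(1) by force
    fix z assume "z \<in> slit \<delta> - {0}"
    then obtain s where "z = lattice_point \<delta> s 0" "0 \<le> s" "even s" "s \<noteq> 0"
      using origin by (auto simp: slit_altdef[OF \<delta>])
    thus "f z = 0" using * by simp
  qed
  have "is_hm \<delta> f \<longleftrightarrow>
    ((\<forall>z\<in>lattice \<delta> - slit \<delta>. discrete_harmonic_at \<delta> f z) \<and>
      (\<forall>e>0. \<exists>R. \<forall>z\<in>lattice \<delta>. norm z > R \<longrightarrow> \<bar>f z\<bar> < e)) \<and>
    (f 0 = 1 \<and> (\<forall>z\<in>slit \<delta> - {0}. f z = 0)) \<and> (\<forall>z. z \<notin> lattice \<delta> \<longrightarrow> f z = 0)"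
    unfolding is_hm_def by (simp only: conj_ac)
  thus ?thesis
    by (simp only: harm bdry discrete_harmonic_at_lattice_point lattice_decay_iff[OF \<delta>] slit_harmonic_def)
qed

lemma is_hm_unique:
  assumes \<delta>: "\<delta> > 0" and f: "is_hm \<delta> f" and g: "is_hm \<delta> g"
  shows "f = g"
proof
  fix z
  show "f z = g z"
  proof (cases "z \<in> lattice \<delta>")
    case True
    then obtain s k where z: "z = lattice_point \<delta> s k" "even (s + k)"
      by (auto simp: lattice_altdef)
    have "slit_harmonic (\<lambda>s k. f (lattice_point \<delta> s k) - g (lattice_point \<delta> s k))"
      using f g unfolding is_hm_iff[OF \<delta>] by (intro slit_harmonic_diff) blast+
    moreover have "f (lattice_point \<delta> s 0) - g (lattice_point \<delta> s 0) = 0" if "0 \<le> s" "even s" for s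
      using f g that unfolding is_hm_iff[OF \<delta>] by simp
    ultimately have "f (lattice_point \<delta> s k) - g (lattice_point \<delta> s k) = 0"
      using z(2) by (rule slit_harmonic_eq_0)
    thus ?thesis by (simp add: z)
  qed (use f g in \<open>simp add: is_hm_def\<close>)
qed

section \<open>The explicit solution\<close>

definition hm_coeff :: "int \<Rightarrow> int \<Rightarrow> complex" where
  "hm_coeff s k = wcoeff (\<lambda>x. of_real (Cfun x) ^ nat \<bar>k\<bar>) s / (2 * of_real pi)"

lemma hm_coeff_axis:
  "hm_coeff s 0 = of_real (if s \<le> 0 \<and> even s then slit_coeff (nat (- s div 2)) else 0)"
  by (simp add: hm_coeff_def wcoeff_one_eq)

text \<open>Rows with |k| \<ge> K are excluded at once by the estimate uniform in s; each of the
  finitely many other rows contributes a finite set by its own decay.\<close>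

lemma hm_coeff_decay:
  assumes e: "e > 0"
  shows "finite {(s, k). e \<le> norm (hm_coeff s k)}"
proof -
  let ?W = "\<lambda>n. wcoeff (\<lambda>x. of_real (Cfun x) ^ n)"
  have norm_eq: "norm (hm_coeff s k) = norm (?W (nat \<bar>k\<bar>) s) / (2 * pi)" for s k
    by (simp add: hm_coeff_def norm_divide norm_mult)
  have e': "e * (2 * pi) > 0"
    using e by simp
  from wcoeff_Cfun_power_uniform[OF this] obtain K where
    K: "\<And>k s. k \<ge> K \<Longrightarrow> norm (?W k s) < e * (2 * pi)" by blast
  have "{(s, k). e \<le> norm (hm_coeff s k)} \<subseteq>
      (\<Union>n<K. {s. e * (2 * pi) \<le> norm (?W n s)}) \<times> {- int K..int K}"
  proof safe
    fix s k assume "e \<le> norm (hm_coeff s k)"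
    hence le: "e * (2 * pi) \<le> norm (?W (nat \<bar>k\<bar>) s)"
      by (simp add: norm_eq field_simps)
    with K[of "nat \<bar>k\<bar>" s] have "nat \<bar>k\<bar> < K"
      by linarith
    with le show "s \<in> (\<Union>n<K. {s. e * (2 * pi) \<le> norm (?W n s)})" "k \<in> {- int K..int K}"
      by auto
  qed
  moreover have "finite (\<Union>n<K. {s. e * (2 * pi) \<le> norm (?W n s)})"
    using wcoeff_Cfun_power_tendsto_0 e' unfolding tendsto_norm_cofinite_iff by simp
  from finite_cartesian_product[OF this finite_atLeastAtMost_int]
  have "finite ((\<Union>n<K. {s. e * (2 * pi) \<le> norm (?W n s)}) \<times> {- int K..int K})" .
  ultimately show ?thesis
    by (rule finite_subset)
qed

text \<open>Clearing denominators in C + 1/C = 2/cos keeps the identity valid where cos vanishes.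
  The second identity serves the axis, where both vertical exponents are 1: there 4 cos C falls
  short of 4 by exactly 4 |sin|.\<close>

lemma Cfun_quadratic: "cos x * (1 + (Cfun x)\<^sup>2) = 2 * Cfun x"
  and Cfun_mult_cos: "cos x * Cfun x = 1 - \<bar>sin x\<bar>"
proof -
  \<comment> \<open>In terms of t the relation sin^2 + cos^2 = 1 reads cos^2 = t (2 - t), from which
    both identities follow by cancelling t.\<close>
  define t where "t = 1 + \<bar>sin x\<bar>"
  have t: "t > 0" "\<bar>sin x\<bar> = t - 1" and C: "Cfun x = cos x / t"
    by (simp_all add: t_def Cfun_def add_pos_nonneg)
  have "(cos x)\<^sup>2 = 1 - \<bar>sin x\<bar>\<^sup>2"
    by (simp add: cos_squared_eq)
  also have "\<dots> = t * (2 - t)"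
    unfolding t(2) by (simp add: power2_eq_square algebra_simps)
  finally have sq: "cos x * cos x = t * (2 - t)"
    by (simp add: power2_eq_square)
  have "cos x * (1 + (Cfun x)\<^sup>2) * t * t = cos x * (t * t + cos x * cos x)"
    using t(1) by (simp add: C power2_eq_square field_simps)
  also have "\<dots> = 2 * Cfun x * t * t"
    unfolding sq using t(1) by (simp add: C algebra_simps)
  finally show "cos x * (1 + (Cfun x)\<^sup>2) = 2 * Cfun x"
    using t(1) by simp
  show "cos x * Cfun x = 1 - \<bar>sin x\<bar>"
    using t(1) sq unfolding t(2) by (simp add: C)
qed

lemma hm_coeff_harmonic:
  assumes "\<not> (k = 0 \<and> 0 \<le> s)"
  shows "hm_coeff (s + 1) (k + 1) + hm_coeff (s + 1) (k - 1) + hm_coeff (s - 1) (k - 1) + hm_coeff (s - 1) (k + 1)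
    = 4 * hm_coeff s k"
proof -
  let ?c = "\<lambda>k x. complex_of_real (Cfun x) ^ nat \<bar>k\<bar>"
  let ?\<phi> = "\<lambda>x. ?c (k + 1) x + ?c (k - 1) x"
  have "wcoeff (?c (k + 1)) (s + 1) + wcoeff (?c (k - 1)) (s + 1) +
      wcoeff (?c (k - 1)) (s - 1) + wcoeff (?c (k + 1)) (s - 1) = wcoeff ?\<phi> (s - 1) + wcoeff ?\<phi> (s + 1)"
    by (simp add: wcoeff_add bcont_intros)
  also have "\<dots> = wcoeff (\<lambda>x. 2 * of_real (cos x) * ?\<phi> x) s"
    by (intro wcoeff_cos[symmetric] bcont_intros)
  also have "\<dots> = 4 * wcoeff (?c k) s"
  proof (cases "k = 0")
    case False
    have "2 * of_real (cos x) * ?\<phi> x = 4 * ?c k x" for x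
    proof -
      \<comment> \<open>The vertical neighbours have exponents |k| - 1 and |k| + 1, in an order set
        by the sign of \<open>k\<close>; factoring out the smaller power leaves the quadratic
        relation.\<close>
      obtain m where "(nat \<bar>k + 1\<bar> = m + 2 \<and> nat \<bar>k - 1\<bar> = m \<or> nat \<bar>k + 1\<bar> = m \<and> nat \<bar>k - 1\<bar> = m + 2)
          \<and> nat \<bar>k\<bar> = m + 1"
        using False by (intro that[of "nat \<bar>k\<bar> - 1"]) auto
      hence "2 * of_real (cos x) * ?\<phi> x = 2 * of_real (Cfun x) ^ m * of_real (cos x * (1 + (Cfun x)\<^sup>2))"
        and "4 * ?c k x = 2 * of_real (Cfun x) ^ m * of_real (2 * Cfun x)"
        by (auto simp: power2_eq_square algebra_simps)
      thus ?thesis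
        by (simp only: Cfun_quadratic)
    qed
    thus ?thesis
      by (simp only: wcoeff_cmult)
  next
    case True
    \<comment> \<open>The rows above and below the axis carry the same symbol. The defect of
      harmonicity is the coefficient of 4 |sin x|, which vanishes for s < 0.\<close>
    have "2 * of_real (cos x) * ?\<phi> x = 4 * (1 - complex_of_real \<bar>sin x\<bar>)" for x
    proof -
      have "2 * of_real (cos x) * ?\<phi> x = 4 * complex_of_real (cos x * Cfun x)"
        by (simp add: True)
      thus ?thesis
        by (simp add: Cfun_mult_cos)
    qed
    hence "wcoeff (\<lambda>x. 2 * of_real (cos x) * ?\<phi> x) s = 4 * wcoeff (\<lambda>x. 1 - complex_of_real \<bar>sin x\<bar>) s"
      by (simp only: wcoeff_cmult)
    also have "bcont (\<lambda>x. complex_of_real \<bar>sin x\<bar>)"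
      by (rule bcontI[of _ 1]) (auto intro!: continuous_intros)
    hence "wcoeff (\<lambda>x. 1 - complex_of_real \<bar>sin x\<bar>) s = wcoeff (\<lambda>x. 1) s - wcoeff (\<lambda>x. complex_of_real \<bar>sin x\<bar>) s"
      by (intro wcoeff_diff bcont_const)
    also have "\<dots> = wcoeff (?c k) s"
      using True assms wcoeff_abs_sin[of s] by simp
    finally show ?thesis .
  qed
  finally show ?thesis
    unfolding hm_coeff_def by (simp add: add_divide_distrib[symmetric])
qed

text \<open>Uniqueness concerns real functions, hence the split: the real part will be
  \<open>hm\<close>, the imaginary part will vanish.\<close>

lemma slit_harmonic_hm_coeff:
  "slit_harmonic (\<lambda>s k. Re (hm_coeff s k))" "slit_harmonic (\<lambda>s k. Im (hm_coeff s k))"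
proof -
  have dec: "finite {(s, k). even (s + k) \<and> e \<le> \<bar>g (hm_coeff s k)\<bar>}"
    if "e > 0" "\<And>z. \<bar>g z\<bar> \<le> norm z" for e and g :: "complex \<Rightarrow> real"
    by (rule finite_subset[OF _ hm_coeff_decay[OF that(1)]]) (use that(2) order_trans in blast)
  show "slit_harmonic (\<lambda>s k. Re (hm_coeff s k))"
    unfolding slit_harmonic_def
    using arg_cong[OF hm_coeff_harmonic, of _ _ Re] dec[of _ Re] abs_Re_le_cmod by simp
  show "slit_harmonic (\<lambda>s k. Im (hm_coeff s k))"
    unfolding slit_harmonic_def
    using arg_cong[OF hm_coeff_harmonic, of _ _ Im] dec[of _ Im] abs_Im_le_cmod by simp
qed

text \<open>The axis values are real, so the imaginary part has zero data on the slit and uniqueness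
  forces it to be 0.\<close>

lemma Im_hm_coeff:
  assumes "even (s + k)"
  shows "Im (hm_coeff s k) = 0"
  by (rule slit_harmonic_eq_0[OF slit_harmonic_hm_coeff(2) _ assms]) (simp only: hm_coeff_axis Im_complex_of_real)

lemma hm_lattice_point:
  assumes \<delta>: "\<delta> > 0" and even: "even (s + k)"
  shows "complex_of_real (hm \<delta> (lattice_point \<delta> s k)) = hm_coeff s k"
proof -
  \<comment> \<open>On the lattice the quotients by the mesh size are exact integers, so the floors
    recover s and k; the value 0 elsewhere matches the normalisation in
    \<open>is_hm\<close>.\<close>
  define f where "f = (\<lambda>z. if z \<in> lattice \<delta> then Re (hm_coeff \<lfloor>Re z / \<delta>\<rfloor> \<lfloor>Im z / \<delta>\<rfloor>) else 0)"
  have f: "f (lattice_point \<delta> s k) = Re (hm_coeff s k)" if "even (s + k)" for s k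
    using that \<delta> by (auto simp: f_def lattice_altdef)
  have "slit_harmonic (\<lambda>s k. f (lattice_point \<delta> s k))"
  proof -
    have "slit_harmonic (\<lambda>s k. f (lattice_point \<delta> s k)) \<longleftrightarrow> slit_harmonic (\<lambda>s k. Re (hm_coeff s k))"
      unfolding slit_harmonic_def by (simp add: f cong: conj_cong)
    thus ?thesis
      using slit_harmonic_hm_coeff(1) by simp
  qed
  moreover have "f (lattice_point \<delta> s 0) = (if s = 0 then 1 else 0)" if "0 \<le> s" "even s" for s
    using that by (simp add: f hm_coeff_axis slit_coeff_0)
  moreover have "f z = 0" if "z \<notin> lattice \<delta>" for z
    using that by (simp add: f_def)
  ultimately have "is_hm \<delta> f"
    unfolding is_hm_iff[OF \<delta>] by blast
  hence "hm \<delta> = f"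
    unfolding hm_def using is_hm_unique[OF \<delta>] by blast
  thus ?thesis
    using f[OF even] Im_hm_coeff[OF even] by (simp add: complex_eq_iff)
qed

lemma hm_negative_axis:
  assumes "\<delta> > 0"
  shows "hm \<delta> (complex_of_real (- 2 * real n * \<delta>)) = slit_coeff n"
proof -
  have "complex_of_real (- 2 * real n * \<delta>) = lattice_point \<delta> (- 2 * int n) 0"
    by (simp add: lattice_point_def)
  hence "complex_of_real (hm \<delta> (complex_of_real (- 2 * real n * \<delta>))) = hm_coeff (- 2 * int n) 0"
    using hm_lattice_point[OF assms, of "- 2 * int n" 0] by simp
  also have "\<dots> = of_real (slit_coeff n)"
    unfolding hm_coeff_axis by simp
  finally show ?thesis
    by (simp only: of_real_eq_iff)
qed

theorem theorem2p11:
  fixes \<delta> :: real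
  assumes "\<delta> > 0"
  shows "(\<forall>s k :: int. even (s + k) \<longrightarrow>
            complex_of_real (hm \<delta> (complex_of_real \<delta> * (of_int s + \<i> * of_int k))) =
              complex_of_real (1 / (2 * pi)) *
              integral {-pi..pi} (\<lambda>\<theta>. complex_of_real (Cfun \<theta>) ^ nat \<bar>k\<bar>
                  / csqrt (1 - exp (- 2 * \<i> * complex_of_real \<theta>))
                  * exp (- \<i> * of_int s * complex_of_real \<theta>)))
         \<and> (\<forall>s :: nat. hm \<delta> (complex_of_real (- 2 * (real s + 1) * \<delta>)) =
              (real s + 1/2) / (real s + 1) * hm \<delta> (complex_of_real (- 2 * real s * \<delta>)))
         \<and> (\<lambda>s :: nat. hm \<delta> (complex_of_real (- 2 * real s * \<delta>)))
              \<sim>[at_top] (\<lambda>s. 1 / sqrt (pi * real s))"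
proof (intro conjI allI impI)
  fix s k :: int
  assume "even (s + k)"
  hence "complex_of_real (hm \<delta> (complex_of_real \<delta> * (of_int s + \<i> * of_int k))) = hm_coeff s k"
    using hm_lattice_point[OF assms] by (simp add: lattice_point_def)
  also have "\<dots> = complex_of_real (1 / (2 * pi)) * wcoeff (\<lambda>x. of_real (Cfun x) ^ nat \<bar>k\<bar>) s"
    by (simp add: hm_coeff_def)
  also have "wcoeff (\<lambda>x. of_real (Cfun x) ^ nat \<bar>k\<bar>) s =
      integral {-pi..pi} (\<lambda>\<theta>. complex_of_real (Cfun \<theta>) ^ nat \<bar>k\<bar>
        / csqrt (1 - exp (- 2 * \<i> * complex_of_real \<theta>)) * exp (- \<i> * of_int s * complex_of_real \<theta>))"
  proof -
    have "exp (- 2 * \<i> * complex_of_real x) = cis (- 2 * x)"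
      "exp (- \<i> * of_int s * complex_of_real x) = cis (- of_int s * x)" for x
      unfolding cis_conv_exp by (rule arg_cong[of _ _ exp], simp)+
    thus ?thesis
      unfolding wcoeff_def weight_def integral_punctured by (simp only: times_divide_eq_right mult_1_right)
  qed
  finally show "complex_of_real (hm \<delta> (complex_of_real \<delta> * (of_int s + \<i> * of_int k))) =
      complex_of_real (1 / (2 * pi)) * integral {-pi..pi} (\<lambda>\<theta>. complex_of_real (Cfun \<theta>) ^ nat \<bar>k\<bar>
        / csqrt (1 - exp (- 2 * \<i> * complex_of_real \<theta>)) * exp (- \<i> * of_int s * complex_of_real \<theta>))" .
next
  fix s :: nat
  have "real s + 1 = real (Suc s)" by simp
  thus "hm \<delta> (complex_of_real (- 2 * (real s + 1) * \<delta>)) =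
      (real s + 1/2) / (real s + 1) * hm \<delta> (complex_of_real (- 2 * real s * \<delta>))"
    by (simp only: hm_negative_axis[OF assms] slit_coeff_Suc)
next
  show "(\<lambda>s :: nat. hm \<delta> (complex_of_real (- 2 * real s * \<delta>))) \<sim>[at_top] (\<lambda>s. 1 / sqrt (pi * real s))"
    unfolding hm_negative_axis[OF assms] by (rule slit_coeff_asymp)
qed

end
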